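(* Let $\lambda>-1/2$, $\lambda\neq 0$, and $\rho>1$. There is a sequence of positive numbers $c=c_n$ with $c_n\to1$ as $n\to\infty$ such that the following holds for all $n\ge 1$. Let $u$ be analytic on and within the Bernstein ellipse $\mathcal E_\rho$, let $M_\rho=\max_{z\in\mathcal E_\rho}|u(z)|$, and let $I_nu$ be the polynomial of degree at most $n$ interpolating $u$ at the $n+1$ Gegenbauer-Gauss-Lobatto points $\{x_j\}_{j=0}^n$ (the zeros of $(1-x^2)C_{n-1}^{\lambda+1}(x)$). Then: (a) $$\max_{|x|\le1}|(u-I_nu)(x)|\le \frac{4c\,M_\rho\sqrt{\rho^2+\rho^{-2}}\,(1+\rho^{-2})^{\lambda+1}}{(1-\rho^{-1})^2(\rho-\rho^{-1})^2}\,\frac{\Gamma(\lambda+1)}{\Gamma(2\lambda+2)}\,\frac{n^{\lambda+1}}{\rho^n};$$ (b) $$\max_{0\le j\le n}|(u-I_nu)'(x_j)|\le \frac{8c\,M_\rho\sqrt{\rho^2+\rho^{-2}}\,(1+\rho^{-2})^{\lambda+1}}{(1-\rho^{-1})^2(\rho-\rho^{-1})^2}\,\frac{\Gamma(\lambda+2)}{\Gamma(2\lambda+4)}\,\frac{n^{\lambda+3}}{\rho^n}.$$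
   Context: For $\mu>-1/2$, $\mu\ne0$, the Gegenbauer polynomials are defined by $C_0^\mu(x)=1$, $C_1^\mu(x)=2\mu x$, and $nC_n^\mu(x)=2(n+\mu-1)xC_{n-1}^\mu(x)-(n+2\mu-2)C_{n-2}^\mu(x)$ for $n\ge2$. They are orthogonal on $[-1,1]$ with respect to the weight $(1-x^2)^{\mu-1/2}$, so $(1-x^2)C_{n-1}^{\lambda+1}(x)$ has $n+1$ distinct zeros in $[-1,1]$. For $\rho>1$ the Bernstein ellipse is $\mathcal E_\rho=\{z\in\mathbb C: z=\tfrac12(w+w^{-1}),\ w=\rho e^{\mathrm i\theta},\ \theta\in[0,2\pi]\}$; it has foci $\pm1$. *)

theory Defs
  imports "HOL-Complex_Analysis.Complex_Analysis"
begin

text \<open>The three-term recurrence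
  \<open>n C\<^sub>n = 2 (n + \<mu> - 1) x C\<^sub>n\<^sub>-\<^sub>1 - (n + 2 \<mu> - 2) C\<^sub>n\<^sub>-\<^sub>2\<close>, read at \<open>n + 2\<close> and divided by \<open>n + 2\<close>.\<close>

fun gegenbauer :: "real \<Rightarrow> nat \<Rightarrow> real poly" where
  "gegenbauer \<mu> 0 = 1"
| "gegenbauer \<mu> (Suc 0) = [:0, 2 * \<mu>:]"
| "gegenbauer \<mu> (Suc (Suc n)) =
     smult (1 / (real n + 2))
       (smult (2 * (real n + 1 + \<mu>)) ([:0, 1:] * gegenbauer \<mu> (Suc n))
        - smult (real n + 2 * \<mu>) (gegenbauer \<mu> n))"

text \<open>The set \<open>{x\<^sub>0, \<dots>, x\<^sub>n}\<close> of zeros of \<open>(1 - x\<^sup>2) C\<^sub>n\<^sub>-\<^sub>1(x)\<close> with parameter \<open>lam + 1\<close>;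
  meaningful for \<open>n \<ge> 1\<close>.\<close>

definition gegenbauer_lobatto :: "real \<Rightarrow> nat \<Rightarrow> real set" where
  "gegenbauer_lobatto lam n =
     {x. poly ([:1, 0, -1:] * gegenbauer (lam + 1) (n - 1)) x = 0}"

text \<open>Well defined when \<open>X\<close> consists of \<open>n + 1\<close> points.\<close>

definition interpolant :: "nat \<Rightarrow> real set \<Rightarrow> (complex \<Rightarrow> complex) \<Rightarrow> complex poly" where
  "interpolant n X u =
     (THE p. degree p \<le> n \<and> (\<forall>x\<in>X. poly p (of_real x) = u (of_real x)))"

definition bernstein_ellipse :: "real \<Rightarrow> complex set" where
  "bernstein_ellipse \<rho> =
     {(w + inverse w) / 2 | w \<theta>.
        w = of_real \<rho> * exp (\<i> * of_real \<theta>) \<and> \<theta> \<in> {0..2 * pi}}"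

end

(* Writing Q(x) = (1 - x^2) C_{n-1}^{lam+1}(x), Hermite's remainder formula reads
     (u - I_n u)(x) = Q(x) / (2 pi i) * contour integral over the ellipse of u(z) / (Q(z) (z - x)).
   On [-1,1] the polynomial |C_m^mu| is at most C_m^mu(1) = (2 mu)_m / m!.  On the ellipse,
   z = (w + 1/w) / 2 with |w| = rho, the generating function (1 - w t)^(-mu) (1 - t/w)^(-mu) gives
     C_m^mu(z) = sum over k of g_k g_{m-k} w^(m-2k),  where g_k = (mu)_k / k!,
   so that C_m^mu(z) / (g_m w^m) tends to (1 - w^(-2))^(-mu) uniformly, by Tannery's theorem and the
   bound g_{m-k} / g_m <= k + 1.  Hence |C_m^mu| is asymptotically at least
   g_m rho^m (1 + rho^(-2))^(-mu), and the ratios of Gamma functions come from the asymptotics of the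
   two Pochhammer symbols.  The derivative at a node is the limit of difference quotients, so it is
   bounded by |Q'(x_j)| times the bound on the contour integral; since |Q'| is only of order
   n C_{n-1}^mu(1), part (b) holds with room to spare. *)
theory Submission
  imports Defs "HOL-Computational_Algebra.Fundamental_Theorem_Algebra" "HOL-Real_Asymp.Real_Asymp"
begin

section \<open>Gegenbauer polynomials\<close>

text \<open>The bounds must hold for every \<open>n \<ge> 1\<close> with a \<open>c\<close> that
  does not depend on \<open>u\<close>, whereas asymptotics control only large \<open>n\<close>.
  Therefore \<open>c\<close> is the exact quotient of an explicit error bound by the claimed main
  term, times a factor tending to 1, and asymptotics enter only in the limit of \<open>c\<close>.
  This needs a positive lower bound for the Gegenbauer polynomial on the ellipse for each single
  \<open>n\<close>, hence zeros confined to the interval [-1,1]. Location and simplicity of the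
  zeros come from the three-term recurrence, along which two expressions stay positive: one excludes
  non-real zeros, the other double ones. The ellipse is handled as the Joukowsky image of the circle
  of radius \<rho>. Its inside is never described explicitly: winding numbers about points of [-1,1]
  are computed on the circle, and they also show that the interval lies where \<open>u\<close> is
  holomorphic. The parameter \<mu> = \<open>lam + 1\<close> exceeds 1/2, which makes all binomial
  weights positive and gives the domination needed for the limit.\<close>

abbreviation cpoly :: "real poly \<Rightarrow> complex poly" where
  "cpoly \<equiv> map_poly complex_of_real"

lemma cpoly_simps:
  "cpoly (p + q) = cpoly p + cpoly q"
  "cpoly (p - q) = cpoly p - cpoly q"
  "cpoly (smult c p) = smult (of_real c) (cpoly p)"
  "cpoly (p * q) = cpoly p * cpoly q"
  "cpoly (pderiv p) = pderiv (cpoly p)"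
  by (rule poly_eqI; simp add: coeff_map_poly coeff_mult coeff_pderiv of_real_sum)+

lemma poly_cpoly_of_real: "poly (cpoly p) (of_real x) = of_real (poly p x)"
  by (induction p) (simp_all add: map_poly_pCons)

lemma degree_cpoly [simp]: "degree (cpoly p) = degree p"
  by (rule degree_map_poly) simp

text \<open>The coefficient of \<open>x\<^sup>k\<close> in \<open>(1 - x) powr (- \<mu>)\<close>.\<close>

definition negbin :: "real \<Rightarrow> nat \<Rightarrow> real" where
  "negbin \<mu> k = pochhammer \<mu> k / fact k"

lemma negbin_0 [simp]: "negbin \<mu> 0 = 1"
  by (simp add: negbin_def)

lemma negbin_Suc: "real (Suc k) * negbin \<mu> (Suc k) = (\<mu> + real k) * negbin \<mu> k"
proof -
  have "real (Suc k) \<noteq> 0" by simp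
  thus ?thesis unfolding negbin_def fact_Suc pochhammer_Suc of_nat_mult
    by (simp add: divide_simps del: of_nat_Suc)
qed

lemma negbin_pos: "\<mu> > 0 \<Longrightarrow> negbin \<mu> k > 0"
  by (simp add: negbin_def pochhammer_pos)

text \<open>Chu-Vandermonde: the coefficient of x^n in (1 - x)^(-a) (1 - x)^(-b). With a = b = \<mu>
  it evaluates the sums of weights in both bounds on [-1,1].\<close>

lemma sum_negbin: "(\<Sum>k\<le>n. negbin a k * negbin b (n - k)) = negbin (a + b) n"
proof -
  have "negbin (a + b) n =
      (\<Sum>k\<le>n. (real (n choose k) * pochhammer a k * pochhammer b (n - k)) / fact n)"
    by (simp add: negbin_def pochhammer_binomial_sum sum_divide_distrib)
  also have "\<dots> = (\<Sum>k\<le>n. negbin a k * negbin b (n - k))"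
    by (intro sum.cong) (auto simp: negbin_def binomial_fact field_simps)
  finally show ?thesis by simp
qed

lemma poly_gegenbauer_Suc_Suc:
  "poly (cpoly (gegenbauer \<mu> (Suc (Suc n)))) z =
     (of_real (2 * (real n + 1 + \<mu>)) * z * poly (cpoly (gegenbauer \<mu> (Suc n))) z
      - of_real (real n + 2 * \<mu>) * poly (cpoly (gegenbauer \<mu> n)) z) / of_nat (n + 2)"
  by (simp add: cpoly_simps map_poly_pCons field_simps)

text \<open>The formal product P of (1 - w t)^(-\<mu>) and (1 - t/w)^(-\<mu>) satisfies (1 - 2 z t +
  t^2) P' = 2 \<mu> (z - t) P. Comparing coefficients gives the Gegenbauer recurrence with the same
  initial values.\<close>

lemma gegenbauer_joukowsky:
  fixes w :: complex
  assumes "w \<noteq> 0"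
  shows "poly (cpoly (gegenbauer \<mu> n)) ((w + inverse w) / 2) =
    (\<Sum>k\<le>n. of_real (negbin \<mu> k * negbin \<mu> (n - k)) * w ^ k * inverse w ^ (n - k))"
proof -
  define F where "F = (\<lambda>a::complex. Abs_fps (\<lambda>k. of_real (negbin \<mu> k) * a ^ k))"
  define v where "v = inverse w"
  define P where "P = F w * F v"
  define z where "z = (w + v) / 2"
  define m where "m = complex_of_real \<mu>"
  have wv: "w * v = 1" using assms by (simp add: v_def)
  \<comment> \<open>The first-order equation of (1 - a t)^(-\<mu>); coefficientwise it is
    \<open>negbin_Suc\<close>.\<close>
  have ode: "(1 - fps_const a * fps_X) * fps_deriv (F a) = fps_const (m * a) * F a" for a
  proof (rule fps_ext)
    fix k
    have *: "of_nat (Suc j) * (of_real (negbin \<mu> (Suc j)) :: complex)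
        = (m + of_nat j) * of_real (negbin \<mu> j)" for j
    proof -
      have "complex_of_real (real (Suc j) * negbin \<mu> (Suc j)) = of_real ((\<mu> + real j) * negbin \<mu> j)"
        by (simp only: negbin_Suc)
      thus ?thesis by (simp add: m_def)
    qed
    show "fps_nth ((1 - fps_const a * fps_X) * fps_deriv (F a)) k = fps_nth (fps_const (m * a) * F a) k"
    proof (cases k)
      case 0
      then show ?thesis using *[of 0] by (simp add: F_def left_diff_distrib mult.assoc)
    next
      case (Suc j)
      have "fps_nth ((1 - fps_const a * fps_X) * fps_deriv (F a)) (Suc j)
        = of_nat (Suc (Suc j)) * of_real (negbin \<mu> (Suc (Suc j))) * a ^ Suc (Suc j)
          - a * (of_nat (Suc j) * of_real (negbin \<mu> (Suc j)) * a ^ Suc j)"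
        by (simp add: F_def left_diff_distrib mult.assoc)
      also have "\<dots> = ((m + of_nat (Suc j)) * of_real (negbin \<mu> (Suc j))) * a ^ Suc (Suc j)
          - a * (of_nat (Suc j) * of_real (negbin \<mu> (Suc j)) * a ^ Suc j)"
        by (simp only: *)
      also have "\<dots> = m * a * (of_real (negbin \<mu> (Suc j)) * a ^ Suc j)"
        by (simp add: algebra_simps)
      finally show ?thesis by (simp add: Suc F_def mult.assoc)
    qed
  qed
  have "(1 - fps_const w * fps_X) * (1 - fps_const v * fps_X) * fps_deriv P
      = (1 - fps_const v * fps_X) * F v * ((1 - fps_const w * fps_X) * fps_deriv (F w))
      + (1 - fps_const w * fps_X) * F w * ((1 - fps_const v * fps_X) * fps_deriv (F v))"
    by (simp add: P_def algebra_simps del: fps_const_mult)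
  also have "\<dots> = fps_const (m * (w + v)) * P - fps_const (2 * m * (w * v)) * (fps_X * P)"
    unfolding ode by (simp add: P_def algebra_simps flip: fps_const_add fps_const_mult)
  finally have "(1 - fps_const w * fps_X) * (1 - fps_const v * fps_X) * fps_deriv P =
      fps_const (m * (w + v)) * P - fps_const (2 * m) * (fps_X * P)"
    using wv by simp
  moreover have "(1 - fps_const w * fps_X) * (1 - fps_const v * fps_X) * fps_deriv P =
      fps_deriv P - fps_const (w + v) * (fps_X * fps_deriv P)
      + (fps_const w * fps_const v) * (fps_X * (fps_X * fps_deriv P))"
    by (simp add: algebra_simps del: fps_const_mult flip: fps_const_add)
  moreover have two_z: "2 * z = w + v"
    by (simp add: z_def)
  \<comment> \<open>Because \<open>w * v = 1\<close>, the two linear factors multiply to 1 - 2 z t +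
    t^2.\<close>
  ultimately have eq: "fps_deriv P - fps_const (2 * z) * (fps_X * fps_deriv P)
      + fps_X * (fps_X * fps_deriv P) = fps_const (m * (2 * z)) * P - fps_const (2 * m) * (fps_X * P)"
    using wv by (simp add: two_z)
  have P_nth: "fps_nth P n = (\<Sum>k\<le>n. of_real (negbin \<mu> k * negbin \<mu> (n - k)) * w ^ k * v ^ (n - k))" for n
    unfolding P_def fps_mult_nth F_def atLeast0AtMost fps_nth_Abs_fps
    by (intro sum.cong refl) (simp add: mult_ac)
  have P01: "fps_nth P 0 = 1" "fps_nth P (Suc 0) = 2 * m * z"
    by (simp_all add: P_nth negbin_def m_def z_def algebra_simps)
  have P_rec: "of_nat (n + 2) * fps_nth P (Suc (Suc n)) =
      of_real (2 * (real n + 1 + \<mu>)) * z * fps_nth P (Suc n) - of_real (real n + 2 * \<mu>) * fps_nth P n" for n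
  proof -
    have "fps_nth (fps_deriv P - fps_const (2 * z) * (fps_X * fps_deriv P)
      + fps_X * (fps_X * fps_deriv P)) (Suc n)
      = fps_nth (fps_const (m * (2 * z)) * P - fps_const (2 * m) * (fps_X * P)) (Suc n)"
      by (simp only: eq)
    \<comment> \<open>The term t^2 P' contributes n P_n to the coefficient of t^(n+1). It arises
      from index n - 1, so \<open>n = 0\<close> is separate.\<close>
    thus ?thesis by (cases n) (simp_all add: m_def algebra_simps)
  qed
  have "poly (cpoly (gegenbauer \<mu> n)) z = fps_nth P n"
  proof (induction n rule: induct_nat_012)
    case (ge2 n)
    have "poly (cpoly (gegenbauer \<mu> (Suc (Suc n)))) z = (of_nat (n + 2) * fps_nth P (Suc (Suc n))) / of_nat (n + 2)"
      unfolding P_rec poly_gegenbauer_Suc_Suc ge2 ..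
    also have "\<dots> = fps_nth P (Suc (Suc n))"
      by (rule nonzero_mult_div_cancel_left) (simp only: of_nat_eq_0_iff)
    finally show ?case .
  qed (use P01 in \<open>simp_all add: m_def map_poly_pCons mult_ac\<close>)
  thus ?thesis by (simp add: P_nth z_def v_def)
qed

text \<open>The unit circle is mapped onto [-1,1], and there the expansion turns into a cosine sum.
  Its weights are positive for \<mu> > 0, so values and derivatives can be estimated term by
  term.\<close>

lemma gegenbauer_cos:
  "poly (gegenbauer \<mu> n) (cos \<theta>) =
    (\<Sum>k\<le>n. negbin \<mu> k * negbin \<mu> (n - k) * cos ((2 * real k - real n) * \<theta>))"
proof -
  have "(cis \<theta> + inverse (cis \<theta>)) / 2 = of_real (cos \<theta>)"
    by (simp add: complex_eq_iff)
  hence "complex_of_real (poly (gegenbauer \<mu> n) (cos \<theta>)) =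
    (\<Sum>k\<le>n. of_real (negbin \<mu> k * negbin \<mu> (n - k)) * cis \<theta> ^ k * inverse (cis \<theta>) ^ (n - k))"
    using gegenbauer_joukowsky[of "cis \<theta>" \<mu> n] by (simp add: poly_cpoly_of_real)
  also have "\<dots> = (\<Sum>k\<le>n. of_real (negbin \<mu> k * negbin \<mu> (n - k)) * cis ((2 * real k - real n) * \<theta>))"
  proof (intro sum.cong refl)
    fix k assume "k \<in> {..n}"
    hence "real k * \<theta> + real (n - k) * - \<theta> = (2 * real k - real n) * \<theta>"
      by (simp add: of_nat_diff algebra_simps)
    hence "cis \<theta> ^ k * inverse (cis \<theta>) ^ (n - k) = cis ((2 * real k - real n) * \<theta>)"
      by (simp only: cis_inverse Complex.DeMoivre cis_mult)
    thus "of_real (negbin \<mu> k * negbin \<mu> (n - k)) * cis \<theta> ^ k * inverse (cis \<theta>) ^ (n - k)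
        = of_real (negbin \<mu> k * negbin \<mu> (n - k)) * cis ((2 * real k - real n) * \<theta>)"
      by (simp add: mult.assoc)
  qed
  finally show ?thesis
    by (simp add: complex_eq_iff)
qed

lemma abs_gegenbauer_le:
  assumes "\<mu> > 0" "x \<in> {-1..1}"
  shows "\<bar>poly (gegenbauer \<mu> n) x\<bar> \<le> negbin (2 * \<mu>) n"
proof -
  obtain \<theta> where x: "x = cos \<theta>" using assms(2) by (metis atLeastAtMost_iff cos_arccos)
  have "\<bar>poly (gegenbauer \<mu> n) x\<bar> \<le>
      (\<Sum>k\<le>n. \<bar>negbin \<mu> k * negbin \<mu> (n - k) * cos ((2 * real k - real n) * \<theta>)\<bar>)"
    unfolding x gegenbauer_cos by (rule sum_abs)
  also have "\<dots> \<le> (\<Sum>k\<le>n. negbin \<mu> k * negbin \<mu> (n - k))"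
    using negbin_pos[OF assms(1)]
    by (intro sum_mono) (simp add: abs_mult abs_of_pos mult_left_le)
  finally show ?thesis by (simp add: sum_negbin)
qed

text \<open>Differentiating the cosine sum in \<theta> costs at most the largest frequency n, since
  |2k - n| \<le> n. The chain rule puts a factor sin \<theta> on the derivative in x; the weight 1 -
  x^2 = sin^2 \<theta> is at most |sin \<theta>|.\<close>

lemma abs_pderiv_gegenbauer_le:
  assumes "\<mu> > 0" "x \<in> {-1..1}"
  shows "(1 - x\<^sup>2) * \<bar>poly (pderiv (gegenbauer \<mu> n)) x\<bar> \<le> real n * negbin (2 * \<mu>) n"
proof -
  obtain \<theta> where x: "x = cos \<theta>" using assms(2) by (metis atLeastAtMost_iff cos_arccos)
  let ?p = "gegenbauer \<mu> n"
  have "((\<lambda>\<theta>. poly ?p (cos \<theta>)) has_field_derivative poly (pderiv ?p) (cos \<theta>) * - sin \<theta>) (at \<theta>)"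
    by (rule DERIV_chain2[OF poly_DERIV]) (auto intro!: derivative_eq_intros)
  moreover have "((\<lambda>\<theta>. poly ?p (cos \<theta>)) has_field_derivative
      (\<Sum>k\<le>n. negbin \<mu> k * negbin \<mu> (n - k) *
         (- sin ((2 * real k - real n) * \<theta>) * (2 * real k - real n)))) (at \<theta>)"
    unfolding gegenbauer_cos by (auto intro!: derivative_eq_intros sum.cong)
  ultimately have eq: "poly (pderiv ?p) (cos \<theta>) * - sin \<theta> =
      (\<Sum>k\<le>n. negbin \<mu> k * negbin \<mu> (n - k) *
         (- sin ((2 * real k - real n) * \<theta>) * (2 * real k - real n)))"
    by (rule DERIV_unique)
  have "\<bar>poly (pderiv ?p) (cos \<theta>) * - sin \<theta>\<bar> \<le>
      (\<Sum>k\<le>n. \<bar>negbin \<mu> k * negbin \<mu> (n - k) *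
         (- sin ((2 * real k - real n) * \<theta>) * (2 * real k - real n))\<bar>)"
    unfolding eq by (rule sum_abs)
  also have "\<dots> \<le> (\<Sum>k\<le>n. negbin \<mu> k * negbin \<mu> (n - k) * real n)"
  proof (intro sum_mono)
    fix k assume "k \<in> {..n}"
    hence "\<bar>sin ((2 * real k - real n) * \<theta>)\<bar> * \<bar>2 * real k - real n\<bar> \<le> 1 * real n"
      by (intro mult_mono) auto
    thus "\<bar>negbin \<mu> k * negbin \<mu> (n - k) *
         (- sin ((2 * real k - real n) * \<theta>) * (2 * real k - real n))\<bar>
         \<le> negbin \<mu> k * negbin \<mu> (n - k) * real n"
      using negbin_pos[OF assms(1)]
      by (simp add: abs_mult abs_of_pos mult.assoc)
  qed
  also have "\<dots> = real n * negbin (2 * \<mu>) n"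
    by (simp add: sum_negbin flip: sum_distrib_right)
  finally have *: "\<bar>poly (pderiv ?p) x\<bar> * \<bar>sin \<theta>\<bar> \<le> real n * negbin (2 * \<mu>) n"
    by (simp add: abs_mult x)
  have "(1 - x\<^sup>2) * \<bar>poly (pderiv ?p) x\<bar> = \<bar>sin \<theta>\<bar> * (\<bar>poly (pderiv ?p) x\<bar> * \<bar>sin \<theta>\<bar>)"
  proof -
    have "1 - x\<^sup>2 = \<bar>sin \<theta>\<bar> * \<bar>sin \<theta>\<bar>"
      by (simp add: x cos_squared_eq flip: power2_eq_square)
    thus ?thesis by simp
  qed
  also have "\<dots> \<le> 1 * (\<bar>poly (pderiv ?p) x\<bar> * \<bar>sin \<theta>\<bar>)"
    by (intro mult_right_mono) auto
  finally show ?thesis using * by simp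
qed

lemma degree_coeff_gegenbauer:
  assumes "\<mu> > 0"
  shows "degree (gegenbauer \<mu> n) \<le> n \<and> coeff (gegenbauer \<mu> n) n > 0"
  using assms
proof (induction \<mu> n rule: gegenbauer.induct)
  case (3 \<mu> n)
  have "degree (gegenbauer \<mu> (Suc (Suc n))) \<le> Suc (Suc n)"
    using 3 by (intro degree_le) (auto simp: coeff_pCons coeff_eq_0 split: nat.splits)
  moreover have "coeff (gegenbauer \<mu> (Suc (Suc n))) (Suc (Suc n)) > 0"
    using 3 by (simp add: coeff_eq_0 add_pos_pos)
  ultimately show ?case ..
qed auto

lemma degree_gegenbauer:
  assumes "\<mu> > 0"
  shows "degree (gegenbauer \<mu> n) = n"
  using degree_coeff_gegenbauer[OF assms, of n] by (simp add: le_antisym le_degree)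

lemma gegenbauer_nz:
  assumes "\<mu> > 0"
  shows "gegenbauer \<mu> n \<noteq> 0"
  using degree_coeff_gegenbauer[OF assms, of n] by auto

section \<open>Zeros\<close>

text \<open>The imaginary part of \<open>C\<^sub>n\<^sub>+\<^sub>1 / C\<^sub>n\<close> keeps the sign of the imaginary part of the argument.\<close>

lemma gegenbauer_ratio_Im_pos:
  assumes "\<mu> > 0" "Im z \<noteq> 0"
  shows "Im z * Im (poly (cpoly (gegenbauer \<mu> (Suc n))) z * cnj (poly (cpoly (gegenbauer \<mu> n)) z)) > 0"
proof (induction n)
  case 0
  have "Im z * Im (poly (cpoly (gegenbauer \<mu> (Suc 0))) z * cnj (poly (cpoly (gegenbauer \<mu> 0)) z))
      = 2 * \<mu> * (Im z)\<^sup>2"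
    by (simp add: map_poly_pCons power2_eq_square)
  thus ?case using assms by simp
next
  case (Suc n)
  define a where "a = poly (cpoly (gegenbauer \<mu> n)) z"
  define b where "b = poly (cpoly (gegenbauer \<mu> (Suc n))) z"
  define s where "s = 2 * (real n + 1 + \<mu>) / real (n + 2)"
  define t where "t = (real n + 2 * \<mu>) / real (n + 2)"
  have st: "s > 0" "t > 0"
    using assms(1) by (simp_all add: s_def t_def)
  have b: "b \<noteq> 0" using Suc by (auto simp: b_def)
  have eq: "poly (cpoly (gegenbauer \<mu> (Suc (Suc n)))) z = of_real s * z * b - of_real t * a"
    unfolding poly_gegenbauer_Suc_Suc a_def[symmetric] b_def[symmetric] s_def t_def
    by (simp add: diff_divide_distrib)
  \<comment> \<open>After multiplication by \<open>cnj b\<close> the leading term is s z |b|^2, and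
    the imaginary part of -a cnj(b) equals that of b cnj(a), which is the induction
    hypothesis.\<close>
  have "Im z * Im (poly (cpoly (gegenbauer \<mu> (Suc (Suc n)))) z * cnj b) =
      s * ((Re b)\<^sup>2 + (Im b)\<^sup>2) * (Im z)\<^sup>2 + t * (Im z * Im (b * cnj a))"
    unfolding eq by (simp add: algebra_simps power2_eq_square)
  also have "\<dots> > 0"
  proof (rule add_pos_pos)
    show "s * ((Re b)\<^sup>2 + (Im b)\<^sup>2) * (Im z)\<^sup>2 > 0"
      using b st assms(2) by (simp add: sum_power2_gt_zero_iff complex_eq_iff)
    show "t * (Im z * Im (b * cnj a)) > 0"
      using Suc st by (intro mult_pos_pos[of t]) (simp_all only: a_def b_def)
  qed
  finally show ?case by (simp add: b_def)
qed

text \<open>The confluent Christoffel--Darboux kernel is positive.\<close>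

lemma gegenbauer_wronskian_pos:
  assumes "\<mu> > 0"
  shows "poly (pderiv (gegenbauer \<mu> (Suc n)) * gegenbauer \<mu> n
      - gegenbauer \<mu> (Suc n) * pderiv (gegenbauer \<mu> n)) x > 0"
proof (induction n)
  case 0
  show ?case using assms by (simp add: pderiv_pCons)
next
  case (Suc n)
  let ?C = "gegenbauer \<mu>"
  have "poly (pderiv (?C (Suc (Suc n))) * ?C (Suc n) - ?C (Suc (Suc n)) * pderiv (?C (Suc n))) x
    = 2 * (real n + 1 + \<mu>) / (real n + 2) * (poly (?C (Suc n)) x)\<^sup>2 +
      (real n + 2 * \<mu>) / (real n + 2) *
       poly (pderiv (?C (Suc n)) * ?C n - ?C (Suc n) * pderiv (?C n)) x"
    by (simp add: pderiv_smult pderiv_diff pderiv_mult pderiv_pCons power2_eq_square divide_simps)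
       (simp add: algebra_simps)
  also have "\<dots> > 0"
    using Suc assms by (intro add_nonneg_pos mult_pos_pos divide_pos_pos) auto
  finally show ?case .
qed

text \<open>For |x| \<ge> 1 the Joukowsky preimage w of x is real. Multiplied by w^n, the expansion
  becomes a sum of positive weights times squares, which also handles negative x.\<close>

lemma gegenbauer_nonzero_of_real:
  assumes "\<mu> > 0" "\<bar>x\<bar> \<ge> 1"
  shows "poly (gegenbauer \<mu> n) x \<noteq> 0"
proof -
  define w where "w = x + sqrt (x\<^sup>2 - 1)"
  have "x\<^sup>2 \<ge> 1" using assms(2) by (simp add: abs_le_square_iff[of 1, simplified])
  hence ww: "w * (x - sqrt (x\<^sup>2 - 1)) = 1"
    by (simp add: w_def algebra_simps flip: power2_eq_square)
  hence w: "w \<noteq> 0" "inverse w = x - sqrt (x\<^sup>2 - 1)"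
    by (auto intro: inverse_unique)
  have x: "complex_of_real x = (of_real w + inverse (of_real w)) / 2"
  proof -
    have "(w + inverse w) / 2 = x" by (simp add: w(2)) (simp add: w_def)
    thus ?thesis by (metis of_real_add of_real_divide of_real_inverse of_real_numeral)
  qed
  have "complex_of_real (poly (gegenbauer \<mu> n) x) =
      of_real (\<Sum>k\<le>n. negbin \<mu> k * negbin \<mu> (n - k) * w ^ k * inverse w ^ (n - k))"
    using gegenbauer_joukowsky[of "of_real w" \<mu> n] w(1)
    by (simp flip: poly_cpoly_of_real add: x)
  hence "w ^ n * poly (gegenbauer \<mu> n) x =
      (\<Sum>k\<le>n. w ^ n * (negbin \<mu> k * negbin \<mu> (n - k) * w ^ k * inverse w ^ (n - k)))"
    by (simp only: of_real_eq_iff sum_distrib_left)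
  also have "\<dots> = (\<Sum>k\<le>n. negbin \<mu> k * negbin \<mu> (n - k) * (w ^ k)\<^sup>2)"
  proof (intro sum.cong refl)
    fix k assume "k \<in> {..n}"
    hence "w ^ n = w ^ k * w ^ (n - k)" by (simp flip: power_add)
    thus "w ^ n * (negbin \<mu> k * negbin \<mu> (n - k) * w ^ k * inverse w ^ (n - k)) =
        negbin \<mu> k * negbin \<mu> (n - k) * (w ^ k)\<^sup>2"
      using w(1) by (simp add: power2_eq_square field_simps)
  qed
  also have "\<dots> > 0"
    using negbin_pos[OF assms(1)] w(1) by (intro sum_pos) auto
  finally show ?thesis by auto
qed

lemma gegenbauer_root:
  assumes "\<mu> > 0" "poly (cpoly (gegenbauer \<mu> n)) z = 0"
  obtains x where "z = of_real x" "\<bar>x\<bar> < 1"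
proof -
  have "Im z = 0"
    using gegenbauer_ratio_Im_pos[OF assms(1), of z n] assms(2) by auto
  then obtain x where x: "z = of_real x" by (metis complex_is_Real_iff Reals_cases)
  moreover have "\<bar>x\<bar> < 1"
    using assms gegenbauer_nonzero_of_real[of \<mu> x n] by (force simp: x poly_cpoly_of_real)
  ultimately show ?thesis by (rule that)
qed

section \<open>The Lobatto polynomial: simple zeros in [-1,1] and size on that interval\<close>

definition lobatto_poly :: "real \<Rightarrow> nat \<Rightarrow> real poly" where
  "lobatto_poly lam n = [:1, 0, -1:] * gegenbauer (lam + 1) (n - 1)"

lemma gegenbauer_lobatto_eq: "gegenbauer_lobatto lam n = {x. poly (lobatto_poly lam n) x = 0}"
  by (simp only: gegenbauer_lobatto_def lobatto_poly_def)

lemma poly_lobatto_poly: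
  "poly (cpoly (lobatto_poly lam n)) z = (1 - z\<^sup>2) * poly (cpoly (gegenbauer (lam + 1) (n - 1))) z"
  "poly (lobatto_poly lam n) x = (1 - x\<^sup>2) * poly (gegenbauer (lam + 1) (n - 1)) x"
  unfolding lobatto_poly_def cpoly_simps(4) poly_mult
  by (simp_all add: map_poly_pCons power2_eq_square)

lemma poly_pderiv_lobatto_poly:
  "poly (pderiv (lobatto_poly lam n)) x =
     (1 - x\<^sup>2) * poly (pderiv (gegenbauer (lam + 1) (n - 1))) x
     - 2 * x * poly (gegenbauer (lam + 1) (n - 1)) x"
  unfolding lobatto_poly_def pderiv_mult poly_add poly_mult
  by (simp add: pderiv_pCons power2_eq_square)

lemma lobatto_root:
  assumes "lam > -1" "poly (cpoly (lobatto_poly lam n)) z = 0"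
  obtains x where "z = of_real x" "x \<in> {-1..1}"
proof (cases "z\<^sup>2 = 1")
  case True
  hence "z = of_real 1 \<or> z = of_real (-1)" by (simp add: power2_eq_1_iff)
  thus ?thesis using that by fastforce
next
  case False
  hence "poly (cpoly (gegenbauer (lam + 1) (n - 1))) z = 0"
    using assms(2) by (simp add: poly_lobatto_poly)
  then obtain x where "z = of_real x" "\<bar>x\<bar> < 1"
    using gegenbauer_root[of "lam + 1"] assms(1) by force
  thus ?thesis by (intro that) auto
qed

lemma degree_lobatto_poly:
  assumes "lam > -1" "n \<ge> 1"
  shows "degree (lobatto_poly lam n) = n + 1"
  unfolding lobatto_poly_def
  using assms by (subst degree_mult_eq) (auto simp: gegenbauer_nz degree_gegenbauer)

text \<open>At the endpoints the Gegenbauer factor does not vanish, so the zero of 1 - x^2 stays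
  simple. In the interior a double zero would be a common zero of that factor and its derivative,
  where the Wronskian would vanish.\<close>

lemma rsquarefree_lobatto_poly:
  assumes "lam > -1"
  shows "rsquarefree (cpoly (lobatto_poly lam n))"
  unfolding rsquarefree_roots
proof (intro allI notI; elim conjE)
  fix z assume z: "poly (cpoly (lobatto_poly lam n)) z = 0" "poly (pderiv (cpoly (lobatto_poly lam n))) z = 0"
  then obtain x where x: "z = of_real x" "x \<in> {-1..1}" using lobatto_root[OF assms] by blast
  let ?C = "gegenbauer (lam + 1) (n - 1)"
  have "poly (lobatto_poly lam n) x = 0" "poly (pderiv (lobatto_poly lam n)) x = 0"
    using z by (simp_all add: x poly_cpoly_of_real flip: cpoly_simps)
  hence 0: "(1 - x\<^sup>2) * poly ?C x = 0" "(1 - x\<^sup>2) * poly (pderiv ?C) x - 2 * x * poly ?C x = 0"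
    by (simp_all add: poly_lobatto_poly poly_pderiv_lobatto_poly)
  show False
  proof (cases "x\<^sup>2 = 1")
    case True
    hence "\<bar>x\<bar> = 1" "x \<noteq> 0" by (auto simp: power2_eq_1_iff)
    thus False using 0(2) True gegenbauer_nonzero_of_real[of "lam + 1" x "n - 1"] assms by auto
  next
    case False
    hence "poly ?C x = 0" "poly (pderiv ?C) x = 0" using 0 by auto
    thus False using gegenbauer_wronskian_pos[of "lam + 1" "n - 1" x] assms by simp
  qed
qed

lemma card_rsquarefree_roots:
  fixes p :: "complex poly"
  assumes "rsquarefree p"
  shows "card {z. poly p z = 0} = degree p"
proof -
  have "p \<noteq> 0" using assms by (auto simp: rsquarefree_def)
  have "degree p = degree (smult (lead_coeff p) (\<Prod>z | poly p z = 0. [:-z, 1:]))"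
    by (simp only: complex_poly_decompose_rsquarefree[OF assms])
  also have "\<dots> = card {z. poly p z = 0}"
    using \<open>p \<noteq> 0\<close> by (simp add: degree_prod_sum_eq)
  finally show ?thesis by simp
qed

text \<open>Complex zeros are counted by the degree, since all are simple; the count passes to the
  reals because every complex zero is real.\<close>

lemma
  assumes "lam > -1" "n \<ge> 1"
  shows card_gegenbauer_lobatto: "card (gegenbauer_lobatto lam n) = n + 1"
    and finite_gegenbauer_lobatto: "finite (gegenbauer_lobatto lam n)"
    and gegenbauer_lobatto_subset: "gegenbauer_lobatto lam n \<subseteq> {-1..1}"
proof -
  have eq: "{z. poly (cpoly (lobatto_poly lam n)) z = 0} = of_real ` gegenbauer_lobatto lam n"
  proof (intro equalityI subsetI)
    fix z assume "z \<in> {z. poly (cpoly (lobatto_poly lam n)) z = 0}"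
    moreover from this obtain x where "z = of_real x" using lobatto_root[OF assms(1)] by blast
    ultimately show "z \<in> of_real ` gegenbauer_lobatto lam n"
      by (simp add: gegenbauer_lobatto_eq poly_cpoly_of_real)
  qed (auto simp: gegenbauer_lobatto_eq poly_cpoly_of_real)
  have "card (complex_of_real ` gegenbauer_lobatto lam n) = n + 1"
    using card_rsquarefree_roots[OF rsquarefree_lobatto_poly[OF assms(1), of n]]
    by (simp add: eq degree_lobatto_poly[OF assms])
  thus *: "card (gegenbauer_lobatto lam n) = n + 1"
    by (subst (asm) card_image) (auto simp: inj_on_def)
  thus "finite (gegenbauer_lobatto lam n)"
    using card.infinite by fastforce
  show "gegenbauer_lobatto lam n \<subseteq> {-1..1}"
  proof
    fix x assume "x \<in> gegenbauer_lobatto lam n"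
    hence "poly (cpoly (lobatto_poly lam n)) (of_real x) = 0"
      by (simp add: gegenbauer_lobatto_eq poly_cpoly_of_real)
    from lobatto_root[OF assms(1) this] show "x \<in> {-1..1}" by auto
  qed
qed

text \<open>The factor \<open>n + 1\<close> is (n - 1) + 2: the first summand from differentiating
  the Gegenbauer factor of degree n - 1, the second from differentiating 1 - x^2.\<close>

lemma
  assumes "lam > -1" "x \<in> {-1..1}" "n \<ge> 1"
  shows abs_lobatto_poly_le: "\<bar>poly (lobatto_poly lam n) x\<bar> \<le> negbin (2 * lam + 2) (n - 1)"
    and abs_pderiv_lobatto_poly_le:
      "\<bar>poly (pderiv (lobatto_poly lam n)) x\<bar> \<le> (real n + 1) * negbin (2 * lam + 2) (n - 1)"
proof -
  let ?C = "gegenbauer (lam + 1) (n - 1)"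
  have x2: "0 \<le> 1 - x\<^sup>2" "1 - x\<^sup>2 \<le> 1" using assms(2) by (auto simp: abs_square_le_1)
  have C: "\<bar>poly ?C x\<bar> \<le> negbin (2 * lam + 2) (n - 1)"
    using abs_gegenbauer_le[of "lam + 1" x "n - 1"] assms by (simp add: algebra_simps)
  have "\<bar>poly (lobatto_poly lam n) x\<bar> = (1 - x\<^sup>2) * \<bar>poly ?C x\<bar>"
    using x2 by (simp add: poly_lobatto_poly abs_mult)
  also have "\<dots> \<le> 1 * \<bar>poly ?C x\<bar>" using x2 by (intro mult_right_mono) auto
  finally show "\<bar>poly (lobatto_poly lam n) x\<bar> \<le> negbin (2 * lam + 2) (n - 1)" using C by simp
  have "poly (pderiv (lobatto_poly lam n)) x = (1 - x\<^sup>2) * poly (pderiv ?C) x - 2 * x * poly ?C x"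
    by (rule poly_pderiv_lobatto_poly)
  also have "\<bar>\<dots>\<bar> \<le> (1 - x\<^sup>2) * \<bar>poly (pderiv ?C) x\<bar> + 2 * (\<bar>x\<bar> * \<bar>poly ?C x\<bar>)"
    using x2 by (intro order_trans[OF abs_triangle_ineq4]) (simp add: abs_mult)
  also have "\<dots> \<le> real (n - 1) * negbin (2 * lam + 2) (n - 1) + 2 * (1 * negbin (2 * lam + 2) (n - 1))"
  proof (rule add_mono)
    show "2 * (\<bar>x\<bar> * \<bar>poly ?C x\<bar>) \<le> 2 * (1 * negbin (2 * lam + 2) (n - 1))"
      using assms C by (intro mult_left_mono mult_mono) auto
    show "(1 - x\<^sup>2) * \<bar>poly (pderiv ?C) x\<bar> \<le> real (n - 1) * negbin (2 * lam + 2) (n - 1)"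
      using abs_pderiv_gegenbauer_le[of "lam + 1" x "n - 1"] assms by (simp add: distrib_left)
  qed
  finally show "\<bar>poly (pderiv (lobatto_poly lam n)) x\<bar> \<le> (real n + 1) * negbin (2 * lam + 2) (n - 1)"
    using assms(3) by (simp add: of_nat_diff algebra_simps)
qed

section \<open>The Bernstein ellipse\<close>

definition joukowsky :: "complex \<Rightarrow> complex" where
  "joukowsky w = (w + inverse w) / 2"

lemma has_field_derivative_joukowsky:
  "w \<noteq> 0 \<Longrightarrow> (joukowsky has_field_derivative (1 - inverse (w\<^sup>2)) / 2) (at w)"
  unfolding joukowsky_def [abs_def]
  by (auto intro!: derivative_eq_intros simp: field_simps power2_eq_square)

lemma holomorphic_joukowsky: "joukowsky holomorphic_on - {0}"
  unfolding joukowsky_def [abs_def] by (auto intro!: holomorphic_intros)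

lemma joukowsky_cis: "joukowsky (cis \<theta>) = of_real (cos \<theta>)"
  by (simp add: joukowsky_def complex_eq_iff)

text \<open>Both \<open>a\<close> and \<open>inverse a\<close> have the same Joukowsky image. For x
  in [-1,1] both lie on the unit circle, which yields the distance bound and the winding
  number.\<close>

lemma joukowsky_diff:
  assumes "w \<noteq> 0" "a \<noteq> 0"
  shows "joukowsky w - joukowsky a = (w - a) * (w - inverse a) / (2 * w)"
  using assms by (simp add: joukowsky_def field_simps)

lemma bernstein_ellipse_eq:
  assumes "\<rho> > 0"
  shows "bernstein_ellipse \<rho> = joukowsky ` sphere 0 \<rho>"
proof (intro equalityI subsetI)
  fix z assume "z \<in> bernstein_ellipse \<rho>"
  then obtain \<theta> where "z = joukowsky (of_real \<rho> * exp (\<i> * of_real \<theta>))"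
    by (auto simp: bernstein_ellipse_def joukowsky_def)
  thus "z \<in> joukowsky ` sphere 0 \<rho>"
    using assms by (auto simp: norm_mult)
next
  fix z assume "z \<in> joukowsky ` sphere 0 \<rho>"
  then obtain w where w: "norm w = \<rho>" "z = joukowsky w" by auto
  have "w = of_real \<rho> * exp (\<i> * of_real (Arg2pi w))"
    using Arg2pi_eq[of w] w by simp
  thus "z \<in> bernstein_ellipse \<rho>"
    using w Arg2pi_ge_0[of w] Arg2pi_lt_2pi[of w]
    by (force simp: bernstein_ellipse_def joukowsky_def)
qed

lemma compact_bernstein_ellipse:
  assumes "\<rho> > 0"
  shows "compact (bernstein_ellipse \<rho>)"
  unfolding bernstein_ellipse_eq[OF assms]
  by (intro compact_continuous_image holomorphic_on_imp_continuous_on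
        holomorphic_on_subset[OF holomorphic_joukowsky]) (use assms in auto)

lemma bernstein_ellipse_nonempty:
  assumes "\<rho> > 0"
  shows "bernstein_ellipse \<rho> \<noteq> {}"
  using assms by (simp add: bernstein_ellipse_eq)

text \<open>Each linear factor of the factorised difference is at least \<rho> - 1 in modulus. The
  resulting (\<rho> - 1)^2 / (2 \<rho>) is the exact distance between a focus and the nearer vertex
  of the major axis.\<close>

lemma bernstein_ellipse_dist:
  assumes "\<rho> > 1" "z \<in> bernstein_ellipse \<rho>" "x \<in> {-1..1}"
  shows "cmod (z - of_real x) \<ge> \<rho> * (1 - 1 / \<rho>)\<^sup>2 / 2"
proof -
  obtain \<theta> where x: "x = cos \<theta>" using assms(3) by (metis atLeastAtMost_iff cos_arccos)
  obtain w where w: "norm w = \<rho>" "z = joukowsky w"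
    using assms by (auto simp: bernstein_ellipse_eq)
  have *: "cmod (w - a) \<ge> \<rho> - 1" if "cmod a = 1" for a
    using norm_triangle_ineq2[of w a] that w(1) by simp
  have "\<rho> * (1 - 1 / \<rho>)\<^sup>2 / 2 = (\<rho> - 1) * (\<rho> - 1) / (2 * \<rho>)"
    using assms(1) by (simp add: power2_eq_square field_simps)
  also have "\<dots> \<le> cmod (w - cis \<theta>) * cmod (w - inverse (cis \<theta>)) / (2 * \<rho>)"
    using assms(1) * by (intro divide_right_mono mult_mono) auto
  also have "\<dots> = cmod (joukowsky w - joukowsky (cis \<theta>))"
    using w assms(1) by (subst joukowsky_diff) (auto simp: norm_mult norm_divide)
  finally show ?thesis by (simp add: w x joukowsky_cis)
qed

text \<open>In the circle variable, 1 - z^2 = -((w - 1/w) / 2)^2.\<close>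

lemma bernstein_ellipse_one_minus_square:
  assumes "\<rho> > 1" "z \<in> bernstein_ellipse \<rho>"
  shows "cmod (1 - z\<^sup>2) \<ge> (\<rho> - 1 / \<rho>)\<^sup>2 / 4"
proof -
  obtain w where w: "norm w = \<rho>" "z = joukowsky w"
    using assms by (auto simp: bernstein_ellipse_eq)
  have "w \<noteq> 0" using w(1) assms by auto
  hence "1 - z\<^sup>2 = - ((w - inverse w)\<^sup>2 / 4)"
    by (simp add: w joukowsky_def power2_eq_square field_simps)
  hence "cmod (1 - z\<^sup>2) = (cmod (w - inverse w))\<^sup>2 / 4"
    by (simp add: norm_power norm_divide)
  moreover have "cmod (w - inverse w) \<ge> \<rho> - 1 / \<rho>"
    using norm_triangle_ineq2[of w "inverse w"] w(1) by (simp add: norm_inverse divide_inverse)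
  moreover have "1 / \<rho> \<le> \<rho>" using assms(1) by (simp add: field_simps) (smt (verit) mult_less_cancel_left1)
  ultimately show ?thesis by (simp add: power_mono)
qed

section \<open>Contour integrals and winding numbers on the ellipse\<close>

definition bernstein_path :: "real \<Rightarrow> real \<Rightarrow> complex" where
  "bernstein_path \<rho> = joukowsky \<circ> circlepath 0 \<rho>"

lemma path_image_bernstein_path:
  assumes "\<rho> > 0"
  shows "path_image (bernstein_path \<rho>) = bernstein_ellipse \<rho>"
  using assms by (simp add: bernstein_path_def path_image_compose bernstein_ellipse_eq)

lemma valid_path_bernstein_path:
  assumes "\<rho> > 0"
  shows "valid_path (bernstein_path \<rho>)"
  unfolding bernstein_path_def
  by (rule valid_path_compose_holomorphic[OF _ holomorphic_joukowsky]) (use assms in auto)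

lemma loop_bernstein_path: "pathfinish (bernstein_path \<rho>) = pathstart (bernstein_path \<rho>)"
  by (simp add: bernstein_path_def pathfinish_compose pathstart_compose)

lemma contour_integral_bernstein_path:
  assumes "\<rho> > 0"
  shows "contour_integral (bernstein_path \<rho>) f =
    contour_integral (circlepath 0 \<rho>) (\<lambda>w. (1 - inverse (w\<^sup>2)) / 2 * f (joukowsky w))"
proof -
  have "contour_integral (bernstein_path \<rho>) f =
      contour_integral (circlepath 0 \<rho>) (\<lambda>w. deriv joukowsky w * f (joukowsky w))"
    unfolding bernstein_path_def
    by (rule contour_integral_comp_analyticW[of _ "-{0}"])
       (use assms holomorphic_joukowsky in \<open>auto simp: analytic_on_open open_Compl\<close>)
  also have "\<dots> = contour_integral (circlepath 0 \<rho>) (\<lambda>w. (1 - inverse (w\<^sup>2)) / 2 * f (joukowsky w))"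
    by (rule contour_integral_cong)
       (use assms in \<open>auto simp: DERIV_imp_deriv[OF has_field_derivative_joukowsky]\<close>)
  finally show ?thesis .
qed

text \<open>Pulled back to the circle, the integrand is the logarithmic derivative of (w - a)(w -
  1/a) / w, where \<open>a\<close> is a unimodular preimage of x. All three poles lie inside the
  circle, and the residues sum to 1 + 1 - 1 = 1.\<close>

lemma winding_number_bernstein_path:
  assumes "\<rho> > 1" "x \<in> {-1..1}"
  shows "winding_number (bernstein_path \<rho>) (of_real x) = 1"
proof -
  obtain \<theta> where x: "x = cos \<theta>" using assms(2) by (metis atLeastAtMost_iff cos_arccos)
  have "\<rho> * (1 - 1 / \<rho>)\<^sup>2 > 0" using assms(1) by simp
  hence notin: "of_real x \<notin> bernstein_ellipse \<rho>"
    using bernstein_ellipse_dist[OF assms(1) _ assms(2), of "of_real x"] by force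
  define a where "a = cis \<theta>"
  have a: "a \<noteq> 0" "cmod a = 1" by (auto simp: a_def)
  have *: "((\<lambda>w. 1 / (w - b)) has_contour_integral 2 * pi * \<i>) (circlepath 0 \<rho>)"
    if "cmod b < \<rho>" for b
    using Cauchy_integral_circlepath_simple[of "\<lambda>_. 1" 0 \<rho> b] that by simp
  have "((\<lambda>w. 1 / (w - a) + 1 / (w - inverse a) - 1 / (w - 0)) has_contour_integral
      2 * pi * \<i> + 2 * pi * \<i> - 2 * pi * \<i>) (circlepath 0 \<rho>)"
    by (intro has_contour_integral_add has_contour_integral_diff *)
       (use a assms in \<open>auto simp: norm_inverse\<close>)
  hence "contour_integral (circlepath 0 \<rho>) (\<lambda>w. 1 / (w - a) + 1 / (w - inverse a) - 1 / (w - 0)) = 2 * pi * \<i>"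
    by (simp add: contour_integral_unique)
  also have "contour_integral (circlepath 0 \<rho>) (\<lambda>w. 1 / (w - a) + 1 / (w - inverse a) - 1 / (w - 0)) =
      contour_integral (circlepath 0 \<rho>) (\<lambda>w. (1 - inverse (w\<^sup>2)) / 2 * (1 / (joukowsky w - of_real x)))"
  proof (rule contour_integral_cong)
    fix w assume "w \<in> path_image (circlepath 0 \<rho>)"
    hence nz: "cmod w = \<rho>" using assms by simp
    hence nz: "w \<noteq> 0" "w - a \<noteq> 0" "w - inverse a \<noteq> 0"
      using a assms(1) by (auto simp: norm_inverse)
    have "1 / (w - a) + 1 / (w - inverse a) - 1 / (w - 0) = (w\<^sup>2 - 1) / ((w - a) * (w - inverse a) * w)"
      using nz a(1) by (simp add: divide_simps) (simp add: algebra_simps power2_eq_square)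
    also have "\<dots> = (1 - inverse (w\<^sup>2)) / 2 * (1 / (joukowsky w - joukowsky a))"
      using nz a(1) by (simp add: joukowsky_diff divide_simps power2_eq_square)
    finally show "1 / (w - a) + 1 / (w - inverse a) - 1 / (w - 0) =
       (1 - inverse (w\<^sup>2)) / 2 * (1 / (joukowsky w - of_real x))"
      by (simp add: a_def x joukowsky_cis)
  qed simp
  finally have "contour_integral (bernstein_path \<rho>) (\<lambda>w. 1 / (w - of_real x)) = 2 * pi * \<i>"
    using assms(1) by (simp add: contour_integral_bernstein_path)
  thus ?thesis
    using assms(1) notin
    by (subst winding_number_valid_path) (auto simp: valid_path_bernstein_path path_image_bernstein_path)
qed

text \<open>The factor \<open>pi * sqrt (\<rho>\<^sup>2 + 1 / \<rho>\<^sup>2)\<close> bounds the length of the ellipse: by Cauchy--Schwarz,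
  the mean of the speed is at most its root mean square.\<close>

lemma norm_contour_integral_bernstein_path_le:
  assumes "\<rho> > 1" "continuous_on (bernstein_ellipse \<rho>) f"
    and bound: "\<And>z. z \<in> bernstein_ellipse \<rho> \<Longrightarrow> cmod (f z) \<le> B"
  shows "cmod (contour_integral (bernstein_path \<rho>) f) \<le> B * (pi * sqrt (\<rho>\<^sup>2 + 1 / \<rho>\<^sup>2))"
proof -
  define A where "A = \<rho>\<^sup>2 + 1 / \<rho>\<^sup>2"
  define c where "c = (\<lambda>t. circlepath 0 \<rho> t)"
  define g where "g = (\<lambda>t. (1 - inverse ((c t)\<^sup>2)) / 2 * f (joukowsky (c t)) * (2 * pi * \<i> * c t))"
  have A: "A > 0" using assms(1) by (simp add: A_def add_pos_pos)
  have c: "c t = of_real \<rho> * cis (2 * pi * t)" for t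
    by (simp add: c_def circlepath cis_conv_exp mult_ac)
  have c0: "c t \<noteq> 0" "joukowsky (c t) \<in> bernstein_ellipse \<rho>" for t
    using assms(1) by (auto simp: c bernstein_ellipse_eq norm_mult)
  have B: "B \<ge> 0"
    using bound[OF c0(2)[of 0]] norm_ge_zero order_trans by blast
  have "contour_integral (bernstein_path \<rho>) f = integral {0..1} g"
  proof -
    have "contour_integral (bernstein_path \<rho>) f = integral {0..1}
        (\<lambda>t. (1 - inverse ((c t)\<^sup>2)) / 2 * f (joukowsky (c t)) * vector_derivative (circlepath 0 \<rho>) (at t))"
      using assms(1)
      by (subst contour_integral_bernstein_path) (auto simp: contour_integral_integral c_def)
    also have "\<dots> = integral {0..1} g"
      unfolding vector_derivative_circlepath by (simp add: g_def c cis_conv_exp mult_ac)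
    finally show ?thesis .
  qed
  moreover have "norm (integral {0..1} g) \<le>
      integral {0..1} (\<lambda>t. B * pi / sqrt A * (A - cos (4 * pi * t)))"
  proof (rule integral_norm_bound_integral)
    have "continuous_on {0..1} g"
      unfolding g_def using c0
      by (intro continuous_intros continuous_on_compose2[OF assms(2)])
         (auto simp: joukowsky_def c intro!: continuous_intros)
    thus "g integrable_on {0..1}" by (rule integrable_continuous_real)
    show "(\<lambda>t. B * pi / sqrt A * (A - cos (4 * pi * t))) integrable_on {0..1}"
      by (intro integrable_continuous_real continuous_intros)
    fix t :: real
    have "(1 - inverse ((c t)\<^sup>2)) / 2 * (2 * pi * \<i> * c t) = pi * \<i> * (c t - inverse (c t))"
      using c0(1)[of t] by (simp add: field_simps power2_eq_square)
    moreover have "g t = (1 - inverse ((c t)\<^sup>2)) / 2 * (2 * pi * \<i> * c t) * f (joukowsky (c t))"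
      by (simp only: g_def mult_ac)
    ultimately have "norm (g t) = pi * cmod (c t - inverse (c t)) * cmod (f (joukowsky (c t)))"
      by (simp only: norm_mult norm_of_real norm_ii abs_of_pos[OF pi_gt_zero] mult_1_right)
    also have "\<dots> \<le> pi * ((A - cos (4 * pi * t)) / sqrt A) * B"
    proof (intro mult_mono)
      have inv: "inverse (c t) = of_real (1 / \<rho>) * cis (- (2 * pi * t))"
        by (simp add: c divide_inverse)
      have "c t - inverse (c t) = Complex ((\<rho> - 1 / \<rho>) * cos (2 * pi * t)) ((\<rho> + 1 / \<rho>) * sin (2 * pi * t))"
        unfolding inv by (simp add: c complex_eq_iff algebra_simps del: of_real_divide)
      hence "(cmod (c t - inverse (c t)))\<^sup>2 =
          (\<rho> - 1 / \<rho>)\<^sup>2 * (cos (2 * pi * t))\<^sup>2 + (\<rho> + 1 / \<rho>)\<^sup>2 * (sin (2 * pi * t))\<^sup>2"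
        by (simp add: cmod_power2 power_mult_distrib)
      also have "(\<rho> - 1 / \<rho>)\<^sup>2 = A - 2"
        using assms(1) by (simp add: A_def power2_eq_square field_simps)
      also have "(\<rho> + 1 / \<rho>)\<^sup>2 = A + 2"
        using assms(1) by (simp add: A_def power2_eq_square field_simps)
      also have "(A - 2) * (cos (2 * pi * t))\<^sup>2 + (A + 2) * (sin (2 * pi * t))\<^sup>2 = A - 2 * cos (4 * pi * t)"
        using cos_double[of "2 * pi * t"] sin_cos_squared_add[of "2 * pi * t"]
        by (simp add: mult.assoc) (simp add: algebra_simps flip: distrib_left)
      finally have eq: "(cmod (c t - inverse (c t)))\<^sup>2 = A - 2 * cos (4 * pi * t)" .
      \<comment> \<open>The pointwise inequality behind Cauchy-Schwarz. The squared modulus has mean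
        \<open>A\<close>, so \<open>sqrt A\<close> is the optimal weight; the resulting majorant has
        an elementary integral.\<close>
      have "2 * sqrt A * cmod (c t - inverse (c t)) \<le> (sqrt A)\<^sup>2 + (cmod (c t - inverse (c t)))\<^sup>2"
        by (rule sum_squares_bound)
      hence "sqrt A * cmod (c t - inverse (c t)) \<le> A - cos (4 * pi * t)"
        using A by (simp add: eq)
      thus le: "cmod (c t - inverse (c t)) \<le> (A - cos (4 * pi * t)) / sqrt A"
        using A by (simp add: field_simps)
      show "0 \<le> pi * ((A - cos (4 * pi * t)) / sqrt A)"
        using order_trans[OF norm_ge_zero le] by (intro mult_nonneg_nonneg) auto
    qed (use bound c0 in auto)
    finally show "norm (g t) \<le> B * pi / sqrt A * (A - cos (4 * pi * t))"
      by (simp add: mult_ac)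
  qed
  moreover have "integral {0..1} (\<lambda>t. B * pi / sqrt A * (A - cos (4 * pi * t))) = B * (pi * sqrt A)"
  proof -
    have "((\<lambda>t. A - cos (4 * pi * t)) has_integral
        (A * 1 - sin (4 * pi * 1) / (4 * pi)) - (A * 0 - sin (4 * pi * 0) / (4 * pi))) {0..1}"
      by (rule fundamental_theorem_of_calculus)
         (auto intro!: derivative_eq_intros simp flip: has_real_derivative_iff_has_vector_derivative)
    moreover have "sin (4 * pi) = 0"
      using sin_npi[of 4] by simp
    ultimately have "((\<lambda>t. A - cos (4 * pi * t)) has_integral A) {0..1}" by simp
    note integral_unique[OF this]
    hence "integral {0..1} (\<lambda>t. B * pi / sqrt A * (A - cos (4 * pi * t))) = B * pi * (A / sqrt A)"
      by simp
    thus ?thesis using A by (simp add: real_div_sqrt)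
  qed
  ultimately show ?thesis by (simp add: A_def)
qed

text \<open>In Cauchy's formula for u(x), split 1/(z - x) into Q(x) / (Q(z)(z - x)) and (Q(z) -
  Q(x)) / (Q(z)(z - x)). The second part is a polynomial in x of degree at most n; its integral
  against u supplies \<open>p\<close>, the first part the remainder.\<close>

lemma hermite_remainder:
  fixes Q :: "complex poly"
  assumes S: "open S" "u holomorphic_on S"
    and \<gamma>: "valid_path \<gamma>" "pathfinish \<gamma> = pathstart \<gamma>" "path_image \<gamma> \<subseteq> S"
    and outside: "\<And>w. w \<notin> S \<Longrightarrow> winding_number \<gamma> w = 0"
    and Q: "\<And>z. z \<in> path_image \<gamma> \<Longrightarrow> poly Q z \<noteq> 0" "degree Q \<le> n + 1"
  obtains p where "degree p \<le> n"
    "\<And>x. x \<in> S \<Longrightarrow> x \<notin> path_image \<gamma> \<Longrightarrow> winding_number \<gamma> x = 1 \<Longrightarrow>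
       u x - poly p x = poly Q x / (2 * pi * \<i>) * contour_integral \<gamma> (\<lambda>z. u z / (poly Q z * (z - x)))"
proof -
  define I where "I = (\<lambda>k. contour_integral \<gamma> (\<lambda>z. u z * z ^ k / poly Q z))"
  have I: "((\<lambda>z. u z * z ^ k / poly Q z) has_contour_integral I k) \<gamma>" for k
    unfolding I_def
  proof (intro has_contour_integral_integral contour_integrable_holomorphic_simple[OF _ _ \<gamma>(1)])
    have "closed {z. poly Q z = 0}"
      by (intro closed_Collect_eq continuous_intros)
    thus "open (S - {z. poly Q z = 0})" using S(1) by (rule open_Diff[rotated])
    show "(\<lambda>z. u z * z ^ k / poly Q z) holomorphic_on S - {z. poly Q z = 0}"
      by (intro holomorphic_intros holomorphic_on_subset[OF S(2)]) auto
  qed (use Q \<gamma> in auto)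
  \<comment> \<open>Coefficients of the divided difference (Q(z) - Q(x)) / (z - x), expanded in
    powers of x, with the powers of z integrated into the moments \<open>I\<close>.\<close>
  define p where "p = (\<Sum>i\<le>n+1. \<Sum>j<i. monom (coeff Q i * I (i - Suc j) / (2 * pi * \<i>)) j)"
  show thesis
  proof (rule that[of p])
    show "degree p \<le> n"
      unfolding p_def by (intro degree_sum_le) (auto intro: order_trans[OF degree_monom_le])
    fix x assume x: "x \<in> S" "x \<notin> path_image \<gamma>" "winding_number \<gamma> x = 1"
    have Qsum: "poly Q z = (\<Sum>i\<le>n+1. coeff Q i * z ^ i)" for z
      using Q(2) unfolding poly_altdef by (intro sum.mono_neutral_left) (auto simp: coeff_eq_0)
    have "((\<lambda>z. \<Sum>i\<le>n+1. \<Sum>j<i. (coeff Q i * x ^ j) * (u z * z ^ (i - Suc j) / poly Q z))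
        has_contour_integral (\<Sum>i\<le>n+1. \<Sum>j<i. (coeff Q i * x ^ j) * I (i - Suc j))) \<gamma>"
      by (intro has_contour_integral_sum has_contour_integral_lmul I) auto
    moreover have "(\<Sum>i\<le>n+1. \<Sum>j<i. (coeff Q i * x ^ j) * I (i - Suc j)) = 2 * pi * \<i> * poly p x"
      unfolding p_def poly_sum poly_monom sum_distrib_left by (intro sum.cong refl) simp
    moreover have "(\<Sum>i\<le>n+1. \<Sum>j<i. (coeff Q i * x ^ j) * (u z * z ^ (i - Suc j) / poly Q z))
        = u z / (z - x) - poly Q x * (u z / (poly Q z * (z - x)))" if "z \<in> path_image \<gamma>" for z
    proof -
      have zx: "z - x \<noteq> 0" using that x by auto
      have "(\<Sum>i\<le>n+1. \<Sum>j<i. (coeff Q i * x ^ j) * (u z * z ^ (i - Suc j) / poly Q z))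
        = u z / poly Q z * (\<Sum>i\<le>n+1. coeff Q i * (\<Sum>j<i. x ^ j * z ^ (i - Suc j)))"
        unfolding sum_distrib_left by (intro sum.cong refl) simp
      also have "(\<lambda>i. \<Sum>j<i. x ^ j * z ^ (i - Suc j)) = (\<lambda>i. (z ^ i - x ^ i) / (z - x))"
      proof
        fix i
        show "(\<Sum>j<i. x ^ j * z ^ (i - Suc j)) = (z ^ i - x ^ i) / (z - x)"
        proof -
          have "z ^ i - x ^ i = - (x ^ i - z ^ i)" by simp
          also have "\<dots> = (z - x) * (\<Sum>j<i. x ^ j * z ^ (i - Suc j))"
            unfolding power_diff_sumr2 by (simp add: left_diff_distrib mult.commute)
          finally show ?thesis using zx by simp
        qed
      qed
      also have "(\<Sum>i\<le>n+1. coeff Q i * ((z ^ i - x ^ i) / (z - x))) = (poly Q z - poly Q x) / (z - x)"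
        by (simp only: Qsum times_divide_eq_right right_diff_distrib sum_subtractf flip: sum_divide_distrib)
      also have "u z / poly Q z * ((poly Q z - poly Q x) / (z - x)) =
         u z / (z - x) - poly Q x * (u z / (poly Q z * (z - x)))"
        using zx Q(1)[OF that] by (simp add: divide_simps) (simp add: algebra_simps)
      finally show ?thesis .
    qed
    ultimately have 1: "((\<lambda>z. u z / (z - x) - poly Q x * (u z / (poly Q z * (z - x))))
        has_contour_integral 2 * pi * \<i> * poly p x) \<gamma>"
      by (metis (no_types, lifting) has_contour_integral_eq)
    have "((\<lambda>z. u z / (z - x)) has_contour_integral (2 * pi * \<i> * winding_number \<gamma> x * u x)) \<gamma>"
      by (rule Cauchy_integral_formula_global[OF S x(1) \<gamma>(1) _ \<gamma>(2) outside]) (use \<gamma>(3) x in auto)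
    from has_contour_integral_diff[OF this 1]
    have 2: "((\<lambda>z. poly Q x * (u z / (poly Q z * (z - x)))) has_contour_integral
        2 * pi * \<i> * (u x - poly p x)) \<gamma>"
      by (simp add: x(3) algebra_simps)
    show "u x - poly p x =
       poly Q x / (2 * pi * \<i>) * contour_integral \<gamma> (\<lambda>z. u z / (poly Q z * (z - x)))"
    \<comment> \<open>At a zero of \<open>Q\<close> the relation above cannot be divided by Q(x),
      but the prefactor annihilates the right-hand side whatever the integral is.\<close>
    proof (cases "poly Q x = 0")
      case True
      hence "((\<lambda>z. 0) has_contour_integral 2 * pi * \<i> * (u x - poly p x)) \<gamma>" using 2 by simp
      hence "2 * pi * \<i> * (u x - poly p x) = 0"
        using has_contour_integral_unique has_contour_integral_0 by blast
      thus ?thesis using True by simp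
    next
      case False
      hence "((\<lambda>z. u z / (poly Q z * (z - x))) has_contour_integral
          2 * pi * \<i> * (u x - poly p x) / poly Q x) \<gamma>"
        using has_contour_integral_div[OF 2, of "poly Q x"] by simp
      thus ?thesis using False by (simp add: contour_integral_unique)
    qed
  qed
qed

section \<open>Growth on the ellipse\<close>

text \<open>Since (i + 1)^2 \<le> (i + 2)(i + 1/2), the sequence (i + 1)
  \<open>negbin \<mu> i\<close> increases for \<mu> \<ge> 1/2; moreover j + k + 1 \<le> (j + 1)(k +
  1).\<close>

lemma negbin_le:
  assumes "\<mu> \<ge> 1/2"
  shows "negbin \<mu> j \<le> (real k + 1) * negbin \<mu> (j + k)"
proof -
  have pos: "negbin \<mu> i > 0" for i using assms by (intro negbin_pos) auto
  have "incseq (\<lambda>i. (real i + 1) * negbin \<mu> i)"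
  proof (rule incseq_SucI)
    fix i
    have "(real i + 1) * (real i + 1) \<le> (real i + 2) * (1/2 + real i)"
      by (simp add: algebra_simps)
    also have "\<dots> \<le> (real i + 2) * (\<mu> + real i)"
      using assms by (intro mult_left_mono) auto
    finally have "(real i + 1) * (real i + 1) * negbin \<mu> i \<le> (real i + 2) * (\<mu> + real i) * negbin \<mu> i"
      using pos[of i] by (intro mult_right_mono) auto
    also have "\<dots> = (real i + 1) * ((real (Suc i) + 1) * negbin \<mu> (Suc i))"
      using negbin_Suc[of i \<mu>] by (simp add: algebra_simps)
    finally show "(real i + 1) * negbin \<mu> i \<le> (real (Suc i) + 1) * negbin \<mu> (Suc i)"
      by (simp add: mult.assoc)
  qed
  hence "(real j + 1) * negbin \<mu> j \<le> (real (j + k) + 1) * negbin \<mu> (j + k)"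
    by (rule incseqD) simp
  also have "\<dots> \<le> ((real j + 1) * (real k + 1)) * negbin \<mu> (j + k)"
    using pos[of "j + k"] by (intro mult_right_mono) (auto simp: algebra_simps)
  finally show ?thesis by (simp add: mult.assoc)
qed

lemma negbin_ratio_tendsto:
  assumes "\<mu> > 0"
  shows "(\<lambda>n. negbin \<mu> (n - k) / negbin \<mu> n) \<longlonglongrightarrow> 1"
proof (rule LIMSEQ_offset[of _ k])
  have nz: "negbin \<mu> i \<noteq> 0" for i using negbin_pos[OF assms, of i] by simp
  have "(\<lambda>n. negbin \<mu> n / negbin \<mu> (n + k)) \<longlonglongrightarrow> 1"
  proof (induction k)
    case (Suc k)
    have "(\<lambda>n. (real n + real k + 1) / (\<mu> + real n + real k)) \<longlonglongrightarrow> 1"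
      by real_asymp
    from tendsto_mult[OF Suc this] have "(\<lambda>n. negbin \<mu> n / negbin \<mu> (n + k) *
        ((real n + real k + 1) / (\<mu> + real n + real k))) \<longlonglongrightarrow> 1" by simp
    thus ?case
    proof (rule Lim_transform_eventually, intro always_eventually allI)
      fix n
      have "negbin \<mu> (n + k) = (real n + real k + 1) * negbin \<mu> (n + Suc k) / (\<mu> + real n + real k)"
        using negbin_Suc[of "n + k" \<mu>] assms by (simp add: field_simps)
      thus "negbin \<mu> n / negbin \<mu> (n + k) * ((real n + real k + 1) / (\<mu> + real n + real k)) =
          negbin \<mu> n / negbin \<mu> (n + Suc k)"
        using assms nz by (simp add: divide_simps)
    qed
  qed (simp add: nz)
  thus "(\<lambda>n. negbin \<mu> (n + k - k) / negbin \<mu> (n + k)) \<longlonglongrightarrow> 1" by simp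
qed

lemma negbin_sums:
  fixes y :: complex
  assumes "cmod y < 1"
  shows "(\<lambda>k. of_real (negbin \<mu> k) * y ^ k) sums (1 - y) powr (- of_real \<mu>)"
proof -
  have "complex_of_real (negbin \<mu> k) * y ^ k = ((- of_real \<mu>) gchoose k) * (- y) ^ k" for k
  proof -
    have "(- 1 :: complex) ^ k * (- y) ^ k = y ^ k"
      by (simp flip: power_mult_distrib)
    thus ?thesis
      by (simp add: negbin_def gbinomial_pochhammer pochhammer_of_real)
  qed
  thus ?thesis using gen_binomial_complex[of "-y" "- of_real \<mu>"] assms by simp
qed

text \<open>Euler's limit formula for Gamma; the extra factor n / (\<mu> + n - 1) removes the last
  Pochhammer factor and one power of n.\<close>

lemma negbin_asymp:
  assumes "\<mu> > 0"
  shows "(\<lambda>n. negbin \<mu> (n - 1) / real n powr (\<mu> - 1)) \<longlonglongrightarrow> 1 / Gamma \<mu>"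
proof -
  have "Gamma \<mu> > 0" using assms by (rule Gamma_real_pos)
  hence "(\<lambda>n. 1 / Gamma_series' \<mu> n * (real n / (\<mu> + real n - 1))) \<longlonglongrightarrow> 1 / Gamma \<mu> * 1"
    by (intro tendsto_mult tendsto_divide Gamma_series'_LIMSEQ tendsto_const) (simp, real_asymp)
  moreover have "\<forall>\<^sub>F n in sequentially. 1 / Gamma_series' \<mu> n * (real n / (\<mu> + real n - 1)) =
      negbin \<mu> (n - 1) / real n powr (\<mu> - 1)"
    using eventually_gt_at_top[of 0]
  proof eventually_elim
    case (elim n)
    then obtain m where n: "n = Suc m" by (cases n) auto
    have "exp (\<mu> * ln (real n)) = real n powr \<mu>" using elim by (simp add: powr_def)
    moreover have "real n powr \<mu> = real n powr (\<mu> - 1) * real n"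
      using elim by (simp add: powr_diff)
    moreover have "pochhammer \<mu> n = pochhammer \<mu> m * (\<mu> + real n - 1)"
      by (simp add: n pochhammer_Suc)
    moreover have "\<mu> + real n - 1 > 0" using assms n by simp
    ultimately show ?case
      using elim by (simp add: Gamma_series'_def negbin_def n divide_simps)
  qed
  ultimately show ?thesis unfolding mult_1_right by (rule Lim_transform_eventually)
qed

text \<open>The limiting series is bounded below by \<sigma>, up to an error \<delta> that tends to
  0 uniformly on the ellipse. For the finitely many n with \<delta> n \<ge> \<sigma> this says
  nothing, and the positive minimum over the compact ellipse takes over without affecting the
  limit.\<close>

lemma gegenbauer_lower_bound:
  assumes "\<mu> \<ge> 1/2" "\<rho> > 1"
  obtains l where "\<And>n. l n > 0"
    "\<And>n z. z \<in> bernstein_ellipse \<rho> \<Longrightarrow> l n \<le> cmod (poly (cpoly (gegenbauer \<mu> n)) z)"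
    "(\<lambda>n. l n / (negbin \<mu> n * \<rho> ^ n)) \<longlonglongrightarrow> (1 + 1 / \<rho>\<^sup>2) powr (- \<mu>)"
proof -
  have \<mu>: "\<mu> > 0" using assms by simp
  define \<sigma> where "\<sigma> = (1 + 1 / \<rho>\<^sup>2) powr (- \<mu>)"
  define r where "r = 1 / \<rho>\<^sup>2"
  \<comment> \<open>Extension by zero turns the finite expansion into a full series that can be
    compared termwise with the binomial series.\<close>
  define b where "b = (\<lambda>k n. if k \<le> n then negbin \<mu> (n - k) / negbin \<mu> n else 0)"
  define a where "a = (\<lambda>k n. negbin \<mu> k * r ^ k * \<bar>b k n - 1\<bar>)"
  \<comment> \<open>By \<open>negbin_le\<close>, \<open>b k n\<close> lies between 0 and k + 1, so
    its distance from 1 is at most k + 2.\<close>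
  define D where "D = (\<lambda>k. negbin \<mu> k * r ^ k * (real k + 2))"
  \<comment> \<open>Independent of z: on the whole ellipse y = w^(-2) has modulus \<open>r\<close>,
    so the limit is uniform.\<close>
  define \<delta> where "\<delta> = (\<lambda>n. \<Sum>k. a k n)"
  have r: "0 < r" "r < 1" using assms(2) by (auto simp: r_def field_simps)
  have pos: "negbin \<mu> i > 0" for i using \<mu> by (rule negbin_pos)
  have "1 + 1 / \<rho>\<^sup>2 > 0" by (intro add_pos_nonneg) auto
  hence \<sigma>: "\<sigma> > 0" unfolding \<sigma>_def by (subst powr_gt_zero) simp
  have summable_x: "summable (\<lambda>k. negbin \<mu> k * x ^ k)" if "norm x < 1" for x :: real
  proof -
    have "summable (\<lambda>k. complex_of_real (negbin \<mu> k * x ^ k))"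
      using sums_summable[OF negbin_sums[of "of_real x" \<mu>]] that by simp
    thus ?thesis by (simp only: summable_complex_of_real)
  qed
  \<comment> \<open>Termwise differentiation of the binomial series makes the extra factor k
    harmless.\<close>
  have "summable (\<lambda>k. diffs (negbin \<mu>) k * r ^ k)"
    by (rule termdiff_converges[of _ 1]) (use r summable_x in auto)
  hence "summable (\<lambda>k. r * (diffs (negbin \<mu>) k * r ^ k))" by (rule summable_mult)
  also have "(\<lambda>k. r * (diffs (negbin \<mu>) k * r ^ k)) = (\<lambda>k. negbin \<mu> (Suc k) * r ^ Suc k * real (Suc k))"
    by (simp add: diffs_def mult_ac)
  finally have "summable (\<lambda>k. negbin \<mu> k * r ^ k * real k)" by (subst (asm) summable_Suc_iff)
  from summable_add[OF this summable_mult[OF summable_x[of r], of 2]] r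
  have summable_D: "summable D" by (simp add: D_def algebra_simps)
  have a_le: "norm (a k n) \<le> D k" for k n
  proof -
    have "\<bar>b k n - 1\<bar> \<le> real k + 2"
    proof (cases "k \<le> n")
      case True
      have "negbin \<mu> (n - k) / negbin \<mu> n \<le> real k + 1"
        using negbin_le[OF assms(1), of "n - k" k] True pos[of n] by (simp add: divide_simps)
      moreover have "negbin \<mu> (n - k) / negbin \<mu> n \<ge> 0" using pos by (simp add: less_imp_le)
      ultimately show ?thesis using True by (simp add: b_def abs_le_iff)
    qed (simp add: b_def)
    thus ?thesis using pos[of k] r by (simp add: a_def D_def abs_mult mult_left_mono)
  qed
  have summable_a: "summable (\<lambda>k. a k n)" for n
    by (rule summable_comparison_test'[OF summable_D, of 0]) (rule a_le)
  have lim: "(\<lambda>n. a k n) \<longlonglongrightarrow> 0" for k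
  proof -
    have "(\<lambda>n. negbin \<mu> k * r ^ k * \<bar>negbin \<mu> (n - k) / negbin \<mu> n - 1\<bar>) \<longlonglongrightarrow> negbin \<mu> k * r ^ k * \<bar>1 - 1\<bar>"
      by (intro tendsto_intros negbin_ratio_tendsto \<mu>)
    moreover have "\<forall>\<^sub>F n in sequentially. negbin \<mu> k * r ^ k * \<bar>negbin \<mu> (n - k) / negbin \<mu> n - 1\<bar> = a k n"
      using eventually_ge_at_top[of k] by eventually_elim (simp add: a_def b_def)
    ultimately have "(\<lambda>n. a k n) \<longlonglongrightarrow> negbin \<mu> k * r ^ k * \<bar>1 - 1\<bar>"
      by (rule Lim_transform_eventually)
    thus ?thesis by simp
  qed
  have "\<forall>\<^sub>F (k, n) in at_top \<times>\<^sub>F sequentially. norm (a k n) \<le> D k"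
    by (rule always_eventually) (use a_le in auto)
  from tannerys_theorem[where b = "\<lambda>_. 0", OF lim this summable_D trivial_limit_sequentially]
  have "\<delta> \<longlonglongrightarrow> (\<Sum>k. 0)"
    unfolding \<delta>_def by blast
  hence \<delta>: "\<delta> \<longlonglongrightarrow> 0" by simp
  have lower: "negbin \<mu> n * \<rho> ^ n * (\<sigma> - \<delta> n) \<le> cmod (poly (cpoly (gegenbauer \<mu> n)) z)"
    if z: "z \<in> bernstein_ellipse \<rho>" for n z
  proof -
    obtain w where w: "cmod w = \<rho>" "z = joukowsky w"
      using z assms(2) by (auto simp: bernstein_ellipse_eq)
    have w0: "w \<noteq> 0" using w assms(2) by auto
    define y where "y = inverse w ^ 2"
    have y: "cmod y = r" by (simp add: y_def w norm_power norm_inverse r_def divide_inverse power_inverse)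
    define T where "T = (\<Sum>k\<le>n. of_real (negbin \<mu> k * b k n) * y ^ k)"
    have "poly (cpoly (gegenbauer \<mu> n)) z =
        (\<Sum>k\<le>n. of_real (negbin \<mu> k * negbin \<mu> (n - k)) * inverse w ^ k * w ^ (n - k))"
      \<comment> \<open>The expansion at \<open>inverse w\<close> orders the terms so that the
        dominant power w^n belongs to \<open>k = 0\<close>.\<close>
      using gegenbauer_joukowsky[of "inverse w" \<mu> n] w0 by (simp add: w joukowsky_def add.commute)
    also have "\<dots> = of_real (negbin \<mu> n) * w ^ n * T"
      unfolding T_def sum_distrib_left
    proof (intro sum.cong refl)
      fix k assume k: "k \<in> {..n}"
      hence "w ^ n = w ^ k * w ^ (n - k)" by (simp flip: power_add)
      thus "of_real (negbin \<mu> k * negbin \<mu> (n - k)) * inverse w ^ k * w ^ (n - k) =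
          of_real (negbin \<mu> n) * w ^ n * (of_real (negbin \<mu> k * b k n) * y ^ k)"
        using k w0 pos[of n] by (simp add: b_def y_def power2_eq_square power_mult_distrib power_inverse)
    qed
    finally have C: "cmod (poly (cpoly (gegenbauer \<mu> n)) z) = negbin \<mu> n * \<rho> ^ n * cmod T"
      using pos[of n] by (simp add: norm_mult norm_power w)
    have "(\<lambda>k. of_real (negbin \<mu> k * b k n) * y ^ k) sums T"
      unfolding T_def by (rule sums_finite) (auto simp: b_def)
    moreover have "(\<lambda>k. of_real (negbin \<mu> k) * y ^ k) sums (1 - y) powr (- of_real \<mu>)"
      using r y by (intro negbin_sums) simp
    ultimately have "(\<lambda>k. of_real (negbin \<mu> k * b k n) * y ^ k - of_real (negbin \<mu> k) * y ^ k)
        sums (T - (1 - y) powr (- of_real \<mu>))"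
      by (rule sums_diff)
    moreover define d where "d = (\<lambda>k. complex_of_real (negbin \<mu> k * (b k n - 1)) * y ^ k)"
    have "(\<lambda>k. of_real (negbin \<mu> k * b k n) * y ^ k - of_real (negbin \<mu> k) * y ^ k) = d"
      by (simp add: d_def fun_eq_iff algebra_simps)
    ultimately have "d sums (T - (1 - y) powr (- of_real \<mu>))" by simp
    moreover have norm_d: "cmod (d k) = a k n" for k
      using pos[of k] by (simp only: d_def a_def norm_mult norm_power y norm_of_real abs_mult abs_of_pos mult_ac)
    have "cmod (suminf d) \<le> (\<Sum>k. cmod (d k))"
      by (rule summable_norm) (simp only: norm_d summable_a)
    hence "cmod (suminf d) \<le> \<delta> n"
      unfolding \<delta>_def norm_d .
    ultimately have "cmod (T - (1 - y) powr (- of_real \<mu>)) \<le> \<delta> n"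
      by (simp add: sums_iff)
    hence "cmod T \<ge> cmod ((1 - y) powr (- of_real \<mu>)) - \<delta> n"
      using norm_triangle_ineq2[of "(1 - y) powr (- of_real \<mu>)" T] by (simp add: norm_minus_commute)
    moreover have "cmod ((1 - y) powr (- of_real \<mu>)) = cmod (1 - y) powr (- \<mu>)"
      using norm_powr_real_powr'[of "- of_real \<mu>" "1 - y"] by simp
    \<comment> \<open>The exponent is negative, so an upper bound on |1 - y| gives the lower
      bound.\<close>
    moreover have "\<sigma> \<le> cmod (1 - y) powr (- \<mu>)"
      unfolding \<sigma>_def
    proof (rule powr_mono2')
      show "cmod (1 - y) \<le> 1 + 1 / \<rho>\<^sup>2"
        using norm_triangle_ineq4[of 1 y] y by (simp add: r_def)
      have "1 - y \<noteq> 0" using y r(2) norm_one[where ?'a = complex] by force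
      thus "0 < cmod (1 - y)" by simp
      show "- \<mu> \<le> 0" using \<mu> by simp
    qed
    ultimately have "\<sigma> - \<delta> n \<le> cmod T" by linarith
    moreover have "negbin \<mu> n * \<rho> ^ n \<ge> 0" using pos[of n] assms(2) by simp
    ultimately show ?thesis unfolding C by (rule mult_left_mono)
  qed
  have "\<exists>m>0. \<forall>z\<in>bernstein_ellipse \<rho>. m \<le> cmod (poly (cpoly (gegenbauer \<mu> n)) z)" for n
  proof -
    have "\<exists>z0\<in>bernstein_ellipse \<rho>. \<forall>z\<in>bernstein_ellipse \<rho>.
        cmod (poly (cpoly (gegenbauer \<mu> n)) z0) \<le> cmod (poly (cpoly (gegenbauer \<mu> n)) z)"
      using assms(2)
      by (intro continuous_attains_inf compact_bernstein_ellipse bernstein_ellipse_nonempty continuous_intros) auto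
    then obtain z0 where z0: "z0 \<in> bernstein_ellipse \<rho>"
      "\<And>z. z \<in> bernstein_ellipse \<rho> \<Longrightarrow>
         cmod (poly (cpoly (gegenbauer \<mu> n)) z0) \<le> cmod (poly (cpoly (gegenbauer \<mu> n)) z)"
      by blast
    have "poly (cpoly (gegenbauer \<mu> n)) z0 \<noteq> 0"
    proof
      assume "poly (cpoly (gegenbauer \<mu> n)) z0 = 0"
      then obtain x where "z0 = of_real x" "x \<in> {-1..1}"
        by (rule gegenbauer_root[OF \<mu>]) (auto simp: abs_less_iff)
      moreover have "\<rho> * (1 - 1 / \<rho>)\<^sup>2 > 0" using assms(2) by simp
      ultimately show False using bernstein_ellipse_dist[OF assms(2) z0(1), of x] by simp
    qed
    thus ?thesis using z0(2) by (intro exI[of _ "cmod (poly (cpoly (gegenbauer \<mu> n)) z0)"]) auto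
  qed
  then obtain m where m: "\<And>n. m n > 0"
    "\<And>n z. z \<in> bernstein_ellipse \<rho> \<Longrightarrow> m n \<le> cmod (poly (cpoly (gegenbauer \<mu> n)) z)" by metis
  define l where "l = (\<lambda>n. if \<delta> n < \<sigma> then negbin \<mu> n * \<rho> ^ n * (\<sigma> - \<delta> n) else m n)"
  show thesis
  proof (rule that[of l])
    show "l n > 0" for n using m(1) pos assms(2) by (simp add: l_def)
    show "l n \<le> cmod (poly (cpoly (gegenbauer \<mu> n)) z)" if "z \<in> bernstein_ellipse \<rho>" for n z
      using m(2) lower that by (simp add: l_def)
    have "(\<lambda>n. \<sigma> - \<delta> n) \<longlonglongrightarrow> \<sigma> - 0" by (intro tendsto_intros \<delta>)
    moreover have "\<forall>\<^sub>F n in sequentially. \<sigma> - \<delta> n = l n / (negbin \<mu> n * \<rho> ^ n)"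
      using order_tendstoD(2)[OF \<delta> \<sigma>]
    proof eventually_elim
      case (elim n)
      thus ?case using pos[of n] assms(2) by (simp add: l_def)
    qed
    ultimately show "(\<lambda>n. l n / (negbin \<mu> n * \<rho> ^ n)) \<longlonglongrightarrow> (1 + 1 / \<rho>\<^sup>2) powr (- \<mu>)"
      unfolding \<sigma>_def diff_zero by (rule Lim_transform_eventually)
  qed
qed

section \<open>Interpolation error\<close>

lemma interpolant_eqI:
  assumes "card X = n + 1" "degree p \<le> n" "\<And>x. x \<in> X \<Longrightarrow> poly p (of_real x) = u (of_real x)"
  shows "interpolant n X u = p"
  unfolding interpolant_def
proof (rule the_equality)
  fix q assume q: "degree q \<le> n \<and> (\<forall>x\<in>X. poly q (of_real x) = u (of_real x))"
  have "card (complex_of_real ` X) = n + 1"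
    using assms(1) by (subst card_image) (auto simp: inj_on_def)
  thus "q = p"
    using q assms by (intro poly_eqI_degree[of "complex_of_real ` X"]) auto
qed (use assms in auto)

text \<open>The hypothesis controls \<open>f\<close> on a real interval only, so the complex
  derivative is approached through real points of that interval. One-sided limits then cover nodes
  at its endpoints.\<close>

lemma norm_deriv_le_of_bound:
  fixes f :: "complex \<Rightarrow> complex" and q :: "real \<Rightarrow> real"
  assumes f: "(f has_field_derivative D) (at (of_real x))" "f (of_real x) = 0"
    and q: "(q has_field_derivative d) (at x)" "q x = 0"
    and x: "x \<in> {a..b}" "a < b"
    and bound: "\<And>y. y \<in> {a..b} \<Longrightarrow> cmod (f (of_real y)) \<le> \<bar>q y\<bar> * B"
  shows "cmod D \<le> \<bar>d\<bar> * B"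
proof (rule tendsto_le)
  show "at x within {a..b} \<noteq> bot"
    using x by (simp add: trivial_limit_within connected_imp_perfect)
  have "filterlim complex_of_real (at (of_real x)) (at x within {a..b})"
    by (intro filterlim_atI) (auto intro!: tendsto_intros simp: eventually_at_filter)
  with f(1) have "((\<lambda>y. (f (of_real y) - f (of_real x)) / (of_real y - of_real x)) \<longlongrightarrow> D) (at x within {a..b})"
    unfolding has_field_derivative_iff by (rule filterlim_compose)
  thus "((\<lambda>y. cmod ((f (of_real y) - f (of_real x)) / (of_real y - of_real x))) \<longlongrightarrow> cmod D) (at x within {a..b})"
    by (rule tendsto_norm)
  have "((\<lambda>y. (q y - q x) / (y - x)) \<longlongrightarrow> d) (at x within {a..b})"
    using q(1) unfolding has_field_derivative_iff by (rule tendsto_within_subset) simp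
  thus "((\<lambda>y. \<bar>(q y - q x) / (y - x)\<bar> * B) \<longlongrightarrow> \<bar>d\<bar> * B) (at x within {a..b})"
    by (intro tendsto_intros)
  have "cmod ((f (of_real y) - f (of_real x)) / (of_real y - of_real x)) \<le> \<bar>(q y - q x) / (y - x)\<bar> * B"
    if "y \<in> {a..b}" for y
  proof -
    have "cmod (f (of_real y)) / \<bar>y - x\<bar> \<le> (\<bar>q y\<bar> * B) / \<bar>y - x\<bar>"
      by (intro divide_right_mono bound that) auto
    thus ?thesis using f(2) q(2) by (simp add: norm_divide abs_divide flip: of_real_diff)
  qed
  thus "\<forall>\<^sub>F y in at x within {a..b}. cmod ((f (of_real y) - f (of_real x)) / (of_real y - of_real x))
      \<le> \<bar>(q y - q x) / (y - x)\<bar> * B"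
    by (simp add: eventually_at_filter)
qed

text \<open>Hermite's formula bounds the error on [-1,1] by |Q(x)| times a constant \<open>B\<close>
  independent of x. Estimating Q gives the uniform bound, estimating Q' at a node the derivative
  bound.\<close>

lemma lobatto_interpolation_error:
  fixes lam \<rho> :: real and n :: nat and u :: "complex \<Rightarrow> complex"
  assumes lam: "lam > -1" and \<rho>: "\<rho> > 1" and n: "n \<ge> 1"
    and l: "l > 0" "\<And>z. z \<in> bernstein_ellipse \<rho> \<Longrightarrow> l \<le> cmod (poly (cpoly (gegenbauer (lam + 1) (n - 1))) z)"
    and u: "u analytic_on (bernstein_ellipse \<rho> \<union> inside (bernstein_ellipse \<rho>))"
  defines "X \<equiv> gegenbauer_lobatto lam n"
  defines "e \<equiv> (\<lambda>z. u z - poly (interpolant n X u) z)"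
  defines "E \<equiv> 4 * (SUP z\<in>bernstein_ellipse \<rho>. cmod (u z)) * sqrt (\<rho>^2 + 1 / \<rho>^2) / ((1 - 1 / \<rho>)^2 * (\<rho> - 1 / \<rho>)^2)
      * (negbin (2 * lam + 2) (n - 1) / (\<rho> * l))"
  shows "E \<ge> 0"
    and "\<And>x. x \<in> {-1..1} \<Longrightarrow> cmod (e (of_real x)) \<le> E"
    and "\<And>x. x \<in> X \<Longrightarrow> cmod (deriv e (of_real x)) \<le> (real n + 1) * E"
proof -
  define M where "M = (SUP z\<in>bernstein_ellipse \<rho>. cmod (u z))"
  define Q where "Q = lobatto_poly lam n"
  define \<gamma> where "\<gamma> = bernstein_path \<rho>"
  have \<rho>0: "\<rho> > 0" using \<rho> by simp
  have image: "path_image \<gamma> = bernstein_ellipse \<rho>"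
    by (simp add: \<gamma>_def path_image_bernstein_path \<rho>0)
  obtain S where S: "open S" "bernstein_ellipse \<rho> \<union> inside (bernstein_ellipse \<rho>) \<subseteq> S" "u holomorphic_on S"
    using u by (auto simp: analytic_on_holomorphic)
  have valid: "valid_path \<gamma>" "pathfinish \<gamma> = pathstart \<gamma>"
    by (simp_all add: \<gamma>_def valid_path_bernstein_path loop_bernstein_path \<rho>0)
  have wind0: "winding_number \<gamma> w = 0" if "w \<in> outside (bernstein_ellipse \<rho>)" for w
    using that valid by (intro winding_number_zero_in_outside) (auto simp: image valid_path_imp_path)
  have outside: "winding_number \<gamma> w = 0" if "w \<notin> S" for w
    using that S(2) by (intro wind0) (auto simp: outside_inside)
  have dist_pos: "\<rho> * (1 - 1 / \<rho>)\<^sup>2 / 2 > 0" using \<rho> by simp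
  have notin: "of_real x \<notin> bernstein_ellipse \<rho>" if "x \<in> {-1..1}" for x
    using bernstein_ellipse_dist[OF \<rho> _ that, of "of_real x"] dist_pos by force
  have wind1: "winding_number \<gamma> (of_real x) = 1" if "x \<in> {-1..1}" for x
    unfolding \<gamma>_def using \<rho> that by (rule winding_number_bernstein_path)
  \<comment> \<open>Winding number 1 is incompatible with lying off \<open>S\<close>, where it is 0;
    this places the interval inside the domain of \<open>u\<close>.\<close>
  have inS: "of_real x \<in> S" if "x \<in> {-1..1}" for x
    using outside[of "of_real x"] wind1[OF that] by auto
  have "inverse \<rho> < \<rho>" using \<rho> by (intro less_trans[of "inverse \<rho>" 1 \<rho>]) (auto simp: inverse_less_1_iff)
  hence sq_pos: "(\<rho> - 1 / \<rho>)\<^sup>2 > 0" by (simp add: divide_inverse)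
  have Q_lower: "cmod (poly (cpoly Q) z) \<ge> (\<rho> - 1 / \<rho>)\<^sup>2 / 4 * l" if "z \<in> bernstein_ellipse \<rho>" for z
    unfolding Q_def poly_lobatto_poly norm_mult
    using bernstein_ellipse_one_minus_square[OF \<rho> that] l(2)[OF that] l(1) by (intro mult_mono) auto
  have Q_pos: "(\<rho> - 1 / \<rho>)\<^sup>2 / 4 * l > 0" using sq_pos l(1) by simp
  have Q_nz: "poly (cpoly Q) z \<noteq> 0" if "z \<in> bernstein_ellipse \<rho>" for z
    using Q_lower[OF that] Q_pos by auto
  have "degree (cpoly Q) \<le> n + 1"
    using degree_lobatto_poly[OF lam n] by (simp add: Q_def)
  then obtain p where p: "degree p \<le> n"
    "\<And>x. x \<in> S \<Longrightarrow> x \<notin> path_image \<gamma> \<Longrightarrow> winding_number \<gamma> x = 1 \<Longrightarrow>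
       u x - poly p x = poly (cpoly Q) x / (2 * pi * \<i>) * contour_integral \<gamma> (\<lambda>z. u z / (poly (cpoly Q) z * (z - x)))"
    using hermite_remainder[OF S(1,3) valid _ outside, of "cpoly Q" n] S(2) Q_nz image by blast
  have X: "X \<subseteq> {-1..1}" "card X = n + 1" "x \<in> X \<longleftrightarrow> poly Q x = 0" for x
    using gegenbauer_lobatto_subset[OF lam n] card_gegenbauer_lobatto[OF lam n]
    by (simp_all add: X_def gegenbauer_lobatto_eq Q_def)
  have p_error: "u (of_real x) - poly p (of_real x) =
      of_real (poly Q x) / (2 * pi * \<i>) * contour_integral \<gamma> (\<lambda>z. u z / (poly (cpoly Q) z * (z - of_real x)))"
    if "x \<in> {-1..1}" for x
    using p(2)[OF inS[OF that] _ wind1[OF that]] notin[OF that] by (simp add: image poly_cpoly_of_real)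
  have "interpolant n X u = p"
  proof (rule interpolant_eqI[OF X(2) p(1)])
    fix x assume "x \<in> X"
    hence "x \<in> {-1..1}" "poly Q x = 0" using X by auto
    thus "poly p (of_real x) = u (of_real x)" using p_error[of x] by simp
  qed
  hence e: "e = (\<lambda>z. u z - poly p z)" by (simp add: e_def)
  have cont_u: "continuous_on (bernstein_ellipse \<rho>) u"
    using S by (intro holomorphic_on_imp_continuous_on holomorphic_on_subset[OF S(3)]) auto
  have "bdd_above ((\<lambda>z. cmod (u z)) ` bernstein_ellipse \<rho>)"
    by (intro bounded_imp_bdd_above compact_imp_bounded compact_continuous_image
          continuous_on_norm cont_u compact_bernstein_ellipse \<rho>0)
  hence M: "cmod (u z) \<le> M" if "z \<in> bernstein_ellipse \<rho>" for z
    unfolding M_def using that by (intro cSUP_upper)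
  have M0: "M \<ge> 0"
    using bernstein_ellipse_nonempty[OF \<rho>0] M norm_ge_zero order_trans by (metis all_not_in_conv)
  \<comment> \<open>Maximum of the integrand times the bound on the length. The divisors 4 and 2,
    together with the 2 \<pi> of Hermite's formula, produce the constant 4 of
    \<open>E\<close>.\<close>
  define K where "K = M / ((\<rho> - 1 / \<rho>)\<^sup>2 / 4 * l * (\<rho> * (1 - 1 / \<rho>)\<^sup>2 / 2)) * (pi * sqrt (\<rho>\<^sup>2 + 1 / \<rho>\<^sup>2))"
  define B where "B = K / (2 * pi)"
  have e_le: "cmod (e (of_real x)) \<le> \<bar>poly Q x\<bar> * B" if x: "x \<in> {-1..1}" for x
  proof -
    let ?I = "contour_integral \<gamma> (\<lambda>z. u z / (poly (cpoly Q) z * (z - of_real x)))"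
    have "cmod ?I \<le> K"
      unfolding \<gamma>_def K_def
    proof (rule norm_contour_integral_bernstein_path_le[OF \<rho>])
      show "continuous_on (bernstein_ellipse \<rho>) (\<lambda>z. u z / (poly (cpoly Q) z * (z - of_real x)))"
        using Q_nz notin[OF x] by (intro continuous_intros cont_u) auto
      fix z assume z: "z \<in> bernstein_ellipse \<rho>"
      have "(\<rho> - 1 / \<rho>)\<^sup>2 / 4 * l * (\<rho> * (1 - 1 / \<rho>)\<^sup>2 / 2) \<le> cmod (poly (cpoly Q) z) * cmod (z - of_real x)"
        using Q_lower[OF z] bernstein_ellipse_dist[OF \<rho> z x] dist_pos by (intro mult_mono) auto
      thus "cmod (u z / (poly (cpoly Q) z * (z - of_real x)))
          \<le> M / ((\<rho> - 1 / \<rho>)\<^sup>2 / 4 * l * (\<rho> * (1 - 1 / \<rho>)\<^sup>2 / 2))"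
        unfolding norm_divide norm_mult
        by (intro frac_le M z M0 mult_pos_pos[OF Q_pos dist_pos])
    qed
    from mult_left_mono[OF this, of "\<bar>poly Q x\<bar> / (2 * pi)"]
    have "\<bar>poly Q x\<bar> / (2 * pi) * cmod ?I \<le> \<bar>poly Q x\<bar> * B"
      by (simp add: B_def)
    thus ?thesis
      using p_error[OF x] by (simp add: e norm_mult norm_divide)
  qed
  have E: "E = negbin (2 * lam + 2) (n - 1) * B"
    using \<rho> l(1) sq_pos dist_pos by (simp add: E_def B_def K_def M_def[symmetric] divide_simps)
  have B0: "B \<ge> 0"
    unfolding B_def K_def using M0 l(1) \<rho>0
    by (intro divide_nonneg_nonneg mult_nonneg_nonneg) auto
  have "negbin (2 * lam + 2) (n - 1) > 0" using lam by (intro negbin_pos) auto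
  thus "E \<ge> 0" using B0 by (simp add: E)
  show "cmod (e (of_real x)) \<le> E" if "x \<in> {-1..1}" for x
    using e_le[OF that] mult_right_mono[OF abs_lobatto_poly_le[OF lam that n] B0]
    by (simp add: E Q_def)
  show "cmod (deriv e (of_real x)) \<le> (real n + 1) * E" if "x \<in> X" for x
  proof -
    have x: "x \<in> {-1..1}" "poly Q x = 0" using that X by auto
    have "e holomorphic_on S"
      unfolding e by (intro holomorphic_intros S)
    hence "(e has_field_derivative deriv e (of_real x)) (at (of_real x))"
      using S(1) inS[OF x(1)] by (rule holomorphic_derivI)
    moreover have "e (of_real x) = 0" using e_le[OF x(1)] x(2) by simp
    ultimately have "cmod (deriv e (of_real x)) \<le> \<bar>poly (pderiv Q) x\<bar> * B"
      by (rule norm_deriv_le_of_bound[OF _ _ poly_DERIV x(2) x(1) _ e_le]) auto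
    also have "\<dots> \<le> (real n + 1) * negbin (2 * lam + 2) (n - 1) * B"
      unfolding Q_def by (intro mult_right_mono abs_pderiv_lobatto_poly_le lam x n B0)
    finally show ?thesis by (simp add: E)
  qed
qed

theorem theorem4p3:
  fixes lam \<rho> :: real
  assumes "lam > -1/2" and "lam \<noteq> 0" and "\<rho> > 1"
  shows "\<exists>c :: nat \<Rightarrow> real. (\<forall>n. c n > 0) \<and> c \<longlonglongrightarrow> 1 \<and>
    (\<forall>n\<ge>1. \<forall>u :: complex \<Rightarrow> complex.
       u analytic_on (bernstein_ellipse \<rho> \<union> inside (bernstein_ellipse \<rho>)) \<longrightarrow>
       (let M = (SUP z\<in>bernstein_ellipse \<rho>. cmod (u z));
            X = gegenbauer_lobatto lam n;
            e = (\<lambda>z. u z - poly (interpolant n X u) z)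
        in
          (SUP x\<in>{-1..1}. cmod (e (complex_of_real x)))
            \<le> 4 * c n * M * sqrt (\<rho>^2 + 1 / \<rho>^2) * (1 + 1 / \<rho>^2) powr (lam + 1)
                / ((1 - 1 / \<rho>)^2 * (\<rho> - 1 / \<rho>)^2)
              * (Gamma (lam + 1) / Gamma (2 * lam + 2))
              * (real n powr (lam + 1) / \<rho>^n)
        \<and>
          Max ((\<lambda>x. cmod (deriv e (complex_of_real x))) ` X)
            \<le> 8 * c n * M * sqrt (\<rho>^2 + 1 / \<rho>^2) * (1 + 1 / \<rho>^2) powr (lam + 1)
                / ((1 - 1 / \<rho>)^2 * (\<rho> - 1 / \<rho>)^2)
              * (Gamma (lam + 2) / Gamma (2 * lam + 4))
              * (real n powr (lam + 3) / \<rho>^n)))"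
proof -
  define \<mu> where "\<mu> = lam + 1"
  have \<mu>: "\<mu> \<ge> 1/2" "\<mu> > 0" and lam: "lam > -1" using assms(1) by (auto simp: \<mu>_def)
  obtain l where l: "\<And>n. l n > 0"
    "\<And>n z. z \<in> bernstein_ellipse \<rho> \<Longrightarrow> l n \<le> cmod (poly (cpoly (gegenbauer \<mu> n)) z)"
    "(\<lambda>n. l n / (negbin \<mu> n * \<rho> ^ n)) \<longlonglongrightarrow> (1 + 1 / \<rho>\<^sup>2) powr (- \<mu>)"
    using gegenbauer_lower_bound[OF \<mu>(1) assms(3)] by metis
  define G where "G = Gamma \<mu> / Gamma (2 * \<mu>)"
  define \<sigma> where "\<sigma> = (1 + 1 / \<rho>\<^sup>2) powr \<mu>"
  have Gamma: "Gamma \<mu> > 0" "Gamma (2 * \<mu>) > 0" using \<mu> by (auto intro: Gamma_real_pos)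
  hence G: "G > 0" by (simp add: G_def)
  have "1 + 1 / \<rho>\<^sup>2 > 0" by (intro add_pos_nonneg) auto
  hence \<sigma>: "\<sigma> > 0" unfolding \<sigma>_def by (subst powr_gt_zero) simp
  have pos: "negbin a k > 0" if "a > 0" for a k using that by (rule negbin_pos)
  \<comment> \<open>The quotient of the explicit error bound by the main term of (a) without
    \<open>c\<close>; factors depending on \<open>u\<close> cancel.\<close>
  define a where "a = (\<lambda>n. negbin (2 * \<mu>) (n - 1) * \<rho> ^ (n - 1) / (l (n - 1) * (\<sigma> * G * real n powr \<mu>)))"
  \<comment> \<open>The target of (b) is that of (a) times n^2 / (2 lam + 3), while the derivative
    estimate costs n + 1. The added summand covers this quotient and tends to 0. The value at 0 only
    secures positivity.\<close>
  define c where "c = (\<lambda>n. if n = 0 then 1 else a n * (1 + (real n + 1) * (2 * lam + 3) / (real n)\<^sup>2))"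
  have a_pos: "a n > 0" if "n \<ge> 1" for n
    using that pos[of "2 * \<mu>"] \<mu> l(1) \<sigma> G assms(3) by (simp add: a_def)
  have "a \<longlonglongrightarrow> 1"
  proof -
    \<comment> \<open>Normalised so that each factor of \<open>a\<close> has a known limit; the
      powers of n combine through (2\<mu> - 1) - (\<mu> - 1) = \<mu>.\<close>
    define R where "R = (\<lambda>\<mu> n. negbin \<mu> (n - 1) / real n powr (\<mu> - 1))"
    define L where "L = (\<lambda>n. l n / (negbin \<mu> n * \<rho> ^ n))"
    have "L \<longlonglongrightarrow> inverse \<sigma>"
      using l(3) by (simp add: L_def \<sigma>_def powr_minus)
    hence "(\<lambda>n. L (n - 1)) \<longlonglongrightarrow> inverse \<sigma>"
      by (intro LIMSEQ_offset[of "\<lambda>n. L (n - 1)" 1]) simp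
    moreover have "R \<mu> \<longlonglongrightarrow> 1 / Gamma \<mu>" "R (2 * \<mu>) \<longlonglongrightarrow> 1 / Gamma (2 * \<mu>)"
      unfolding R_def using \<mu> by (intro negbin_asymp; simp)+
    ultimately have "(\<lambda>n. R (2 * \<mu>) n / (R \<mu> n * L (n - 1) * (\<sigma> * G))) \<longlonglongrightarrow>
        (1 / Gamma (2 * \<mu>)) / (1 / Gamma \<mu> * inverse \<sigma> * (\<sigma> * G))"
      using \<sigma> G Gamma by (intro tendsto_intros) auto
    also have "(1 / Gamma (2 * \<mu>)) / (1 / Gamma \<mu> * inverse \<sigma> * (\<sigma> * G)) = 1"
      using \<sigma> Gamma by (simp add: G_def field_simps)
    finally have "(\<lambda>n. R (2 * \<mu>) n / (R \<mu> n * L (n - 1) * (\<sigma> * G))) \<longlonglongrightarrow> 1" .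
    moreover have "\<forall>\<^sub>F n in sequentially. R (2 * \<mu>) n / (R \<mu> n * L (n - 1) * (\<sigma> * G)) = a n"
      using eventually_gt_at_top[of 0]
    proof eventually_elim
      case (elim n)
      have "real n powr (2 * \<mu> - 1) = real n powr (\<mu> - 1) * real n powr \<mu>"
        by (simp flip: powr_add)
      thus ?case
        using elim pos[OF \<mu>(2), of "n - 1"] l(1)[of "n - 1"] assms(3)
        by (simp add: R_def L_def a_def divide_simps)
    qed
    ultimately show ?thesis by (rule Lim_transform_eventually)
  qed
  moreover have "(\<lambda>n. 1 + (real n + 1) * (2 * lam + 3) / (real n)\<^sup>2) \<longlonglongrightarrow> 1"
    by real_asymp
  ultimately have "(\<lambda>n. a n * (1 + (real n + 1) * (2 * lam + 3) / (real n)\<^sup>2)) \<longlonglongrightarrow> 1 * 1"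
    by (rule tendsto_mult)
  moreover have "\<forall>\<^sub>F n in sequentially. a n * (1 + (real n + 1) * (2 * lam + 3) / (real n)\<^sup>2) = c n"
    using eventually_gt_at_top[of 0] by eventually_elim (simp add: c_def)
  ultimately have "c \<longlonglongrightarrow> 1" unfolding mult_1_right by (rule Lim_transform_eventually)
  moreover have "c n > 0" for n
  proof (cases "n = 0")
    case False
    have "1 + (real n + 1) * (2 * lam + 3) / (real n)\<^sup>2 > 0"
      using lam by (intro add_pos_nonneg) auto
    thus ?thesis using False a_pos[of n] by (simp add: c_def)
  qed (simp add: c_def)
  moreover have "(let M = (SUP z\<in>bernstein_ellipse \<rho>. cmod (u z));
            X = gegenbauer_lobatto lam n;
            e = (\<lambda>z. u z - poly (interpolant n X u) z)
        in
          (SUP x\<in>{-1..1}. cmod (e (complex_of_real x)))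
            \<le> 4 * c n * M * sqrt (\<rho>^2 + 1 / \<rho>^2) * (1 + 1 / \<rho>^2) powr (lam + 1)
                / ((1 - 1 / \<rho>)^2 * (\<rho> - 1 / \<rho>)^2)
              * (Gamma (lam + 1) / Gamma (2 * lam + 2))
              * (real n powr (lam + 1) / \<rho>^n)
        \<and>
          Max ((\<lambda>x. cmod (deriv e (complex_of_real x))) ` X)
            \<le> 8 * c n * M * sqrt (\<rho>^2 + 1 / \<rho>^2) * (1 + 1 / \<rho>^2) powr (lam + 1)
                / ((1 - 1 / \<rho>)^2 * (\<rho> - 1 / \<rho>)^2)
              * (Gamma (lam + 2) / Gamma (2 * lam + 4))
              * (real n powr (lam + 3) / \<rho>^n))"
    if n: "n \<ge> 1" and u: "u analytic_on (bernstein_ellipse \<rho> \<union> inside (bernstein_ellipse \<rho>))" for n u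
  proof -
    define M where "M = (SUP z\<in>bernstein_ellipse \<rho>. cmod (u z))"
    define X where "X = gegenbauer_lobatto lam n"
    define e where "e = (\<lambda>z. u z - poly (interpolant n X u) z)"
    define W where "W = M * sqrt (\<rho>^2 + 1 / \<rho>^2) / ((1 - 1 / \<rho>)^2 * (\<rho> - 1 / \<rho>)^2)"
    define D where "D = 4 * W * \<sigma> * G * (real n powr \<mu> / \<rho> ^ n)"
    define E where "E = 4 * M * sqrt (\<rho>^2 + 1 / \<rho>^2) / ((1 - 1 / \<rho>)^2 * (\<rho> - 1 / \<rho>)^2)
      * (negbin (2 * lam + 2) (n - 1) / (\<rho> * l (n - 1)))"
    have mu2: "2 * lam + 2 = 2 * \<mu>" by (simp add: \<mu>_def)
    note err = lobatto_interpolation_error[OF lam assms(3) n l(1)[of "n - 1"] l(2)[where n = "n - 1", unfolded \<mu>_def] u,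
        folded X_def M_def, folded e_def E_def]
    have "\<rho> ^ n = \<rho> * \<rho> ^ (n - 1)" using n by (simp flip: power_Suc)
    hence "E = D * a n"
      using n l(1)[of "n - 1"] \<sigma> G assms(3)
      by (simp add: E_def D_def a_def W_def mu2 divide_simps)
    hence D0: "D \<ge> 0" using err(1) a_pos[OF n] by (simp add: zero_le_mult_iff)
    have "a n * 1 \<le> c n"
      unfolding c_def using n lam a_pos[OF n] by (simp add: mult_left_mono)
    hence E1: "E \<le> D * c n" unfolding \<open>E = D * a n\<close> using D0 by (simp add: mult_left_mono)
    have "a n * ((real n + 1) * (2 * lam + 3) / (real n)\<^sup>2) \<le> c n"
    proof -
      have "a n * ((real n + 1) * (2 * lam + 3) / (real n)\<^sup>2) \<le> a n * (1 + (real n + 1) * (2 * lam + 3) / (real n)\<^sup>2)"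
        using a_pos[OF n] by (intro mult_left_mono) auto
      thus ?thesis using n by (simp add: c_def)
    qed
    hence "(real n + 1) * a n \<le> c n * ((real n)\<^sup>2 / (2 * lam + 3))"
      using n lam by (simp add: field_simps)
    hence "D * ((real n + 1) * a n) \<le> D * (c n * ((real n)\<^sup>2 / (2 * lam + 3)))"
      using D0 by (rule mult_left_mono)
    hence E2: "(real n + 1) * E \<le> D * c n * ((real n)\<^sup>2 / (2 * lam + 3))"
      by (simp add: \<open>E = D * a n\<close> mult_ac)
    have "(SUP x\<in>{-1..1}. cmod (e (complex_of_real x))) \<le> E"
      using err(2) by (intro cSUP_least) (auto simp: e_def)
    also note E1
    also have "D * c n = 4 * c n * M * sqrt (\<rho>^2 + 1 / \<rho>^2) * (1 + 1 / \<rho>^2) powr (lam + 1)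
                / ((1 - 1 / \<rho>)^2 * (\<rho> - 1 / \<rho>)^2)
              * (Gamma (lam + 1) / Gamma (2 * lam + 2))
              * (real n powr (lam + 1) / \<rho>^n)"
      unfolding D_def W_def \<sigma>_def G_def mu2 unfolding \<mu>_def by (simp add: mult_ac)
    finally have A: "(SUP x\<in>{-1..1}. cmod (e (complex_of_real x))) \<le> \<dots>" .
    have "finite X" "X \<noteq> {}"
      using finite_gegenbauer_lobatto[OF lam n] card_gegenbauer_lobatto[OF lam n]
      by (auto simp: X_def)
    hence "Max ((\<lambda>x. cmod (deriv e (complex_of_real x))) ` X) \<le> (real n + 1) * E"
      using err(3) by (intro Max.boundedI) auto
    also note E2
    also have "D * c n * ((real n)\<^sup>2 / (2 * lam + 3)) =
        8 * c n * M * sqrt (\<rho>^2 + 1 / \<rho>^2) * (1 + 1 / \<rho>^2) powr (lam + 1)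
                / ((1 - 1 / \<rho>)^2 * (\<rho> - 1 / \<rho>)^2)
              * (Gamma (lam + 2) / Gamma (2 * lam + 4))
              * (real n powr (lam + 3) / \<rho>^n)"
    proof -
      have "Gamma (lam + 2) = \<mu> * Gamma \<mu>"
        using Gamma_plus1[of \<mu>] \<mu> by (auto simp: \<mu>_def add_ac nonpos_Ints_def)
      moreover have "Gamma (2 * lam + 4) = (2 * lam + 3) * (2 * \<mu>) * Gamma (2 * \<mu>)"
        using Gamma_plus1[of "2 * \<mu>"] Gamma_plus1[of "2 * \<mu> + 1"] \<mu>
        by (auto simp: \<mu>_def add_ac nonpos_Ints_def)
      \<comment> \<open>The factor 2\<mu> of the denominator cancels \<mu> from the numerator and
        the 2 taken out of 8 = 4 * 2, leaving only 2\<mu> + 1 = 2 lam + 3.\<close>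
      ultimately have ratio: "2 * (Gamma (lam + 2) / Gamma (2 * lam + 4)) = G / (2 * lam + 3)"
        using \<mu> by (simp add: G_def)
      have power: "real n powr (lam + 3) = real n powr \<mu> * (real n)\<^sup>2"
        using n powr_add[of "real n" \<mu> 2] by (simp add: \<mu>_def add_ac powr_realpow)
      have "8 * c n * M * sqrt (\<rho>^2 + 1 / \<rho>^2) * (1 + 1 / \<rho>^2) powr (lam + 1)
                / ((1 - 1 / \<rho>)^2 * (\<rho> - 1 / \<rho>)^2)
              * (Gamma (lam + 2) / Gamma (2 * lam + 4)) * (real n powr (lam + 3) / \<rho>^n)
          = 4 * c n * W * \<sigma> * (2 * (Gamma (lam + 2) / Gamma (2 * lam + 4))) * (real n powr (lam + 3) / \<rho>^n)"
        by (simp add: W_def \<sigma>_def \<mu>_def)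
      also have "\<dots> = D * c n * ((real n)\<^sup>2 / (2 * lam + 3))"
        unfolding ratio power D_def by (simp add: mult_ac)
      finally show ?thesis by (rule sym)
    qed
    finally show ?thesis
      using A by (simp only: Let_def M_def X_def e_def)
  qed
  ultimately show ?thesis by blast
qed

end
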